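(* Let $\mathcal{S}\subset\mathbb{Z}$ with $\max\mathcal{S}=1$. Let $n(i,s)$ be non-negative integers for $i\in\mathbb{Z}$, $s\in\mathcal{S}$, and assume that either $\min\mathcal{S}=-1$, or $n(i,s)=0$ for all $i<0$ and $s\in\mathcal{S}$. Define $n_i=\sum_{s\in\mathcal{S}}n(i,s)+\chi_{i=0}$, let $\ell$ and $r$ be the smallest and largest $i$ with $n_i>0$, assume $n_i>0$ for all $\ell\le i\le r$, and let $n=\sum_i n_i$ and $c(i)=\sum_{s\in\mathcal{S}}n(i+s,s)$. Then the number of $\mathcal{S}$-embedded Cayley trees in which, for all $i\in\mathbb{Z}$ and $s\in\mathcal{S}$, exactly $n(i,s)$ non-root vertices have out-type $(i;s)$ is $$\frac{n!\prod_{i=\ell}^r n_i^{c(i)-1}\prod_{i=\ell}^{-1}n(i,-1)\prod_{i=1}^r n(i,1)}{\prod_{i,s}n(i,s)!}.$$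
   Context: A rooted Cayley tree of size $n$ is a tree on vertex set $\{1,\ldots,n\}$ with a distinguished root. For $\mathcal{S}\subset\mathbb{Z}$, an $\mathcal{S}$-embedded Cayley tree is a rooted Cayley tree with abscissas $a(v)\in\mathbb{Z}$ such that the root has abscissa $0$ and $a(v')-a(v)\in\mathcal{S}$ whenever $v'$ is a child of $v$. A non-root vertex $v$ has out-type $(i;s)$ if $a(v)=i$ and its parent has abscissa $i-s$. $\chi_P$ is $1$ if $P$ holds and $0$ otherwise. Products over $i,s$ with unspecified range run over $i\in\mathbb{Z}$, $s\in\mathcal{S}$.
   Formalization: Adds the hypothesis that c(i)=0 whenever n_i=0 (some vertex exists at each required parent abscissa); without it the formula fails, e.g. S={-1,1}, n(0,-1)=1, all others 0 gives 1 while no tree exists. Finite support of n(i,s) is made explicit. *)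

theory Defs
  imports Complex_Main "HOL-Library.FuncSet"
begin

definition is_walk :: "'a set set \<Rightarrow> 'a list \<Rightarrow> bool" where
  "is_walk E xs \<longleftrightarrow> xs \<noteq> [] \<and> successively (\<lambda>u v. {u, v} \<in> E) xs"

definition is_path :: "'a set set \<Rightarrow> 'a list \<Rightarrow> bool" where
  "is_path E xs \<longleftrightarrow> is_walk E xs \<and> distinct xs"

definition is_cycle :: "'a set set \<Rightarrow> 'a list \<Rightarrow> bool" where
  "is_cycle E xs \<longleftrightarrow> is_path E xs \<and> 3 \<le> length xs \<and> {last xs, hd xs} \<in> E"

definition simple_graph :: "'a set \<Rightarrow> 'a set set \<Rightarrow> bool" where
  "simple_graph V E \<longleftrightarrow> (\<forall>e\<in>E. e \<subseteq> V \<and> card e = 2)"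

definition connected_graph :: "'a set \<Rightarrow> 'a set set \<Rightarrow> bool" where
  "connected_graph V E \<longleftrightarrow> (\<forall>u\<in>V. \<forall>v\<in>V. \<exists>xs. is_walk E xs \<and> hd xs = u \<and> last xs = v)"

definition is_tree :: "'a set \<Rightarrow> 'a set set \<Rightarrow> bool" where
  "is_tree V E \<longleftrightarrow> simple_graph V E \<and> connected_graph V E \<and> (\<nexists>xs. is_cycle E xs)"

definition rooted_cayley_tree :: "nat \<Rightarrow> nat set set \<Rightarrow> nat \<Rightarrow> bool" where
  "rooted_cayley_tree N E \<rho> \<longleftrightarrow> is_tree {1..N} E \<and> \<rho> \<in> {1..N}"

text \<open>In the tree with edge set \<open>E\<close> rooted at \<open>\<rho>\<close>, the vertex \<open>w\<close> is a child of \<open>v\<close>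
  (and \<open>v\<close> is the parent of \<open>w\<close>) if \<open>v\<close> is the last vertex before \<open>w\<close> on the path from
  \<open>\<rho>\<close> to \<open>w\<close>.\<close>

definition is_child :: "'a set set \<Rightarrow> 'a \<Rightarrow> 'a \<Rightarrow> 'a \<Rightarrow> bool" where
  "is_child E \<rho> w v \<longleftrightarrow> (\<exists>xs. is_path E (xs @ [v, w]) \<and> hd (xs @ [v, w]) = \<rho>)"

text \<open>The abscissas are taken in the extensional function space on the vertex set, so that
  an embedded tree has only one representation and counting makes sense.\<close>

definition embedded_cayley_tree ::
    "int set \<Rightarrow> nat \<Rightarrow> nat set set \<Rightarrow> nat \<Rightarrow> (nat \<Rightarrow> int) \<Rightarrow> bool" where
  "embedded_cayley_tree S N E \<rho> a \<longleftrightarrow>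
     rooted_cayley_tree N E \<rho> \<and> a \<in> {1..N} \<rightarrow>\<^sub>E UNIV \<and> a \<rho> = 0 \<and>
     (\<forall>v\<in>{1..N}. \<forall>w\<in>{1..N}. is_child E \<rho> w v \<longrightarrow> a w - a v \<in> S)"

definition has_out_type ::
    "nat set set \<Rightarrow> nat \<Rightarrow> (nat \<Rightarrow> int) \<Rightarrow> nat \<Rightarrow> int \<Rightarrow> int \<Rightarrow> bool" where
  "has_out_type E \<rho> a v i s \<longleftrightarrow> v \<noteq> \<rho> \<and> a v = i \<and> (\<exists>u. is_child E \<rho> v u \<and> a u = i - s)"

definition embedded_cayley_trees_with_out_types ::
    "int set \<Rightarrow> (int \<Rightarrow> int \<Rightarrow> nat) \<Rightarrow> (nat \<times> nat set set \<times> nat \<times> (nat \<Rightarrow> int)) set" where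
  "embedded_cayley_trees_with_out_types S m =
     {(N, E, \<rho>, a). embedded_cayley_tree S N E \<rho> a \<and>
        (\<forall>i. \<forall>s\<in>S. card {v \<in> {1..N}. has_out_type E \<rho> a v i s} = m i s)}"

text \<open>Below, \<open>m i s\<close> is the prescribed number of vertices of out-type \<open>(i; s)\<close>. As \<open>S\<close> may
  be infinite, sums over \<open>S\<close> are restricted to the nonzero terms.\<close>

definition abscissa_count :: "int set \<Rightarrow> (int \<Rightarrow> int \<Rightarrow> nat) \<Rightarrow> int \<Rightarrow> nat" where
  "abscissa_count S m i = (\<Sum>s | s \<in> S \<and> m i s \<noteq> 0. m i s) + of_bool (i = 0)"

definition child_count :: "int set \<Rightarrow> (int \<Rightarrow> int \<Rightarrow> nat) \<Rightarrow> int \<Rightarrow> nat" where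
  "child_count S m i = (\<Sum>s | s \<in> S \<and> m (i + s) s \<noteq> 0. m (i + s) s)"

end

theory Submission
  imports Defs "HOL-Combinatorics.Multiset_Permutations"
begin

text \<open>A rooted tree is its parent function. Once every vertex has received its out-type (a
  multinomial number of ways), the parent of a vertex is an arbitrary vertex of a prescribed abscissa,
  which gives \<open>\<Prod>i. nn i ^ c i\<close> functions, and one needs the proportion of those in which every vertex
  leads to the root. The abscissas are peeled off one at a time, starting from \<open>0\<close> and moving outwards:
  follow the walks outside the abscissa \<open>i\<close> until they enter it. As they enter at uniform places, a
  weighted Cayley formula shows that abscissa \<open>i\<close> contributes the factor \<open>u / nn i\<close>, where \<open>u\<close> is the
  number of its vertices whose parent lies on the side of \<open>0\<close> (for \<open>i = 0\<close>, the root). By the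
  conditions on \<open>S\<close> these are the vertices of out-type \<open>(i; 1)\<close> for \<open>i > 0\<close> and \<open>(i; -1)\<close> for
  \<open>i < 0\<close>.\<close>

section \<open>Functions leading to a given set\<close>

text \<open>The events that the vertices of the single abscissas lead on towards the root are not
  independent as they stand: a walk may wander far through the outer abscissas before it returns.
  Conditioning removes this. Freeze all choices except those of the vertices whose parent lies at
  the abscissa in question. Either some outer walk fails to reach these vertices, and no completion
  works, or all do, and then the fraction of good completions is the same whatever was frozen. The
  counts are related by \<open>card C * count = card U * count'\<close> instead of quotients, which
  stays meaningful when \<open>U\<close> is empty and both sides vanish. The recursion closes
  because steps towards 0 have length at most 1: an abscissa can be entered from further out only
  from its neighbour.\<close>

inductive hits :: "('a \<Rightarrow> 'a) \<Rightarrow> 'a set \<Rightarrow> 'a \<Rightarrow> bool" for f U where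
  hits_base: "v \<in> U \<Longrightarrow> hits f U v"
| hits_step: "hits f U (f v) \<Longrightarrow> hits f U v"

lemma hits_stepD: "hits f U v \<Longrightarrow> v \<notin> U \<Longrightarrow> hits f U (f v)"
  by (auto elim: hits.cases)

lemma hits_trans:
  assumes "hits f Y v" and "\<And>y. y \<in> Y \<Longrightarrow> hits f U y"
  shows "hits f U v"
  using assms(1) by induction (simp_all add: assms(2), blast intro: hits_step)

lemma hits_mono: "hits f U v \<Longrightarrow> U \<subseteq> U' \<Longrightarrow> hits f U' v"
  by (rule hits_trans) (auto intro: hits_base)

text \<open>The walk stays in \<open>R\<close> until it meets \<open>U\<close>, so only the values
  on \<open>R - U\<close> matter. This is how events on one side of 0 are seen to ignore the choices
  made elsewhere.\<close>

lemma hits_cong_on: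
  assumes "hits f U v" "v \<in> R"
    and "\<And>x. x \<in> R \<Longrightarrow> x \<notin> U \<Longrightarrow> f x \<in> R \<and> g x = f x"
  shows "hits g U v"
  using assms(1,2)
proof induction
  case (hits_step v)
  then show ?case
    using assms(3)[of v] hits.hits_step[of g U v] hits_base[of v U g] by (cases "v \<in> U") auto
qed (rule hits_base)

text \<open>Walks are followed only up to their first visit to \<open>U\<close>. The values on
  \<open>U\<close> can therefore be reset freely, and a root without a parent causes no
  trouble.\<close>

lemma hits_cong:
  assumes "\<And>x. x \<notin> U \<Longrightarrow> f x = g x"
  shows "hits f U v \<longleftrightarrow> hits g U v"
  using assms hits_cong_on[of f U v UNIV g] hits_cong_on[of g U v UNIV f] by auto

lemma not_hits_if_closed:
  assumes "v \<in> Z" "\<And>z. z \<in> Z \<Longrightarrow> f z \<in> Z" "Z \<inter> U = {}"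
  shows "\<not> hits f U v"
proof
  assume "hits f U v"
  then show False using assms(1) by induction (use assms(2,3) in auto)
qed

lemma hits_fixpoint_iff:
  assumes "f x = x"
  shows "hits f U x \<longleftrightarrow> x \<in> U"
  using assms not_hits_if_closed[of x "{x}" f U] by (auto intro: hits_base)

lemma hits_disjoint_fixpoints:
  assumes "hits f U v" "\<And>u. u \<in> U \<union> Y \<Longrightarrow> f u = u" "U \<inter> Y = {}"
  shows "\<not> hits f Y v"
  using assms(1)
proof induction
  case (hits_base v)
  then show ?case using assms(2,3) by (auto simp: hits_fixpoint_iff)
next
  case (hits_step v)
  then show ?case using assms(2) hits_stepD by (metis UnCI hits_base)
qed

lemma hits_Un_iff: "hits f (U \<union> Y) v \<longleftrightarrow> hits f U v \<or> hits f Y v"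
proof
  assume "hits f (U \<union> Y) v"
  then show "hits f U v \<or> hits f Y v"
    by induction (auto intro: hits_base, (blast intro: hits_step)+)
qed (auto intro: hits_mono)

text \<open>A fixed point stands for a vertex whose parent is still undecided. Redirecting it
  extends only the walks that end there, and these go on like the walk that starts at
  \<open>x\<close>.\<close>

lemma hits_fun_upd_iff:
  assumes "f x = x"
  shows "hits (f(x := y)) U v \<longleftrightarrow> hits f U v \<or> hits f {x} v \<and> hits (f(x := y)) U x"
proof -
  have upd: "hits (f(x := y)) Y v" if "hits f Y v" for Y v
    using that
  proof induction
    case (hits_step v)
    then show ?case using assms hits.hits_step[of "f(x := y)" Y v]
      by (cases "v = x") (auto simp: fun_upd_def)
  qed (rule hits_base)
  have "hits f U v \<or> hits f {x} v \<and> hits (f(x := y)) U x" if "hits (f(x := y)) U v"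
    using that
  proof induction
    case (hits_step v)
    then show ?case
      using hits_base[of x "{x}" f] hits.hits_step[of f U v] hits.hits_step[of f "{x}" v]
        hits.hits_step[of "f(x := y)" U x]
      by (cases "v = x") (auto simp: fun_upd_def)
  qed (auto intro: hits_base)
  moreover have "hits (f(x := y)) U v" if "hits f {x} v" "hits (f(x := y)) U x"
    using upd[OF that(1)] that(2) by (auto intro: hits_trans)
  ultimately show ?thesis using upd by blast
qed

text \<open>The choices on \<open>Y\<close> are frozen and those on \<open>X\<close> vary; a
  proportion that is the same for every frozen part can then be pulled out of the sum.\<close>

lemma card_PiE_Un_filter:
  assumes "finite X" "finite Y" "X \<inter> Y = {}" "\<And>v. v \<in> X \<union> Y \<Longrightarrow> finite (A v)"
  shows "card {f \<in> Pi\<^sub>E (X \<union> Y) A. P f} =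
    (\<Sum>g\<in>Pi\<^sub>E Y A. card {F \<in> Pi\<^sub>E X A. P (\<lambda>v. if v \<in> X then F v else g v)})"
proof -
  let ?m = "\<lambda>g F v. if v \<in> X then F v else g v"
  have "bij_betw (\<lambda>f. (restrict f Y, restrict f X)) {f \<in> Pi\<^sub>E (X \<union> Y) A. P f}
     (SIGMA g:Pi\<^sub>E Y A. {F \<in> Pi\<^sub>E X A. P (?m g F)})"
  proof (rule bij_betw_byWitness[where f' = "\<lambda>(g, F). ?m g F"])
    have *: "?m (restrict f Y) (restrict f X) = f" if "f \<in> Pi\<^sub>E (X \<union> Y) A" for f
      using that by (auto simp: PiE_iff extensional_def fun_eq_iff)
    show "\<forall>f\<in>{f \<in> Pi\<^sub>E (X \<union> Y) A. P f}.
        (\<lambda>(g, F). ?m g F) (restrict f Y, restrict f X) = f"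
      using * by simp
    show "(\<lambda>f. (restrict f Y, restrict f X)) ` {f \<in> Pi\<^sub>E (X \<union> Y) A. P f}
        \<subseteq> (SIGMA g:Pi\<^sub>E Y A. {F \<in> Pi\<^sub>E X A. P (?m g F)})"
      using * by (auto simp: PiE_iff)
    show "\<forall>p\<in>SIGMA g:Pi\<^sub>E Y A. {F \<in> Pi\<^sub>E X A. P (?m g F)}.
        (\<lambda>f. (restrict f Y, restrict f X)) ((\<lambda>(g, F). ?m g F) p) = p"
      using assms(3) by (auto simp: PiE_iff extensional_def fun_eq_iff)
    show "(\<lambda>(g, F). ?m g F) ` (SIGMA g:Pi\<^sub>E Y A. {F \<in> Pi\<^sub>E X A. P (?m g F)})
        \<subseteq> {f \<in> Pi\<^sub>E (X \<union> Y) A. P f}"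
      using assms(3) by (auto simp: PiE_iff extensional_def)
  qed
  moreover have "finite (Pi\<^sub>E Y A)" "finite (Pi\<^sub>E X A)"
    using assms by (auto intro!: finite_PiE)
  ultimately show ?thesis
    by (simp add: bij_betw_same_card card_SigmaI)
qed

text \<open>A weighted Cayley formula. If \<open>x \<in> X\<close> is sent to \<open>y \<in> C\<close>, then \<open>y\<close> may not lie in the block
  of the \<open>b\<close> points of \<open>C\<close> that lead to \<open>x\<close>; if \<open>y\<close> is one of the \<open>u\<close> points leading to \<open>U\<close>, this block
  joins them, and otherwise \<open>u\<close> does not change. The induction closes because
  \<open>u * (u + b) + (n - u - b) * u = u * n\<close>.\<close>

lemma card_hitting_completions:
  assumes "finite X" "finite C" "C \<union> X \<subseteq> V" "X \<inter> U = {}"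
    and "\<And>x. x \<in> X \<union> U \<Longrightarrow> h x = x"
    and "\<And>v. v \<in> V \<Longrightarrow> hits h (U \<union> X) v"
  shows "card C * card {F \<in> X \<rightarrow>\<^sub>E C. \<forall>v\<in>V. hits (\<lambda>v. if v \<in> X then F v else h v) U v} =
    card {c \<in> C. hits h U c} * card C ^ card X"
  using assms(1,3-6)
proof (induction X arbitrary: h rule: finite_induct)
  case empty
  have "{F \<in> {} \<rightarrow>\<^sub>E C. \<forall>v\<in>V. hits (\<lambda>v. if v \<in> {} then F v else h v) U v} = {\<lambda>_. undefined}"
    using empty by auto
  \<comment> \<open>With nothing undecided all of \<open>C\<close> leads to \<open>U\<close>. The
    factor \<open>card C\<close> on the left lets the formula include this case, where the exponent
    \<open>card X - 1\<close> would be negative.\<close>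
  moreover have "{c \<in> C. hits h U c} = C" using empty by auto
  ultimately show ?case by (simp only:) simp
next
  case (insert x X)
  let ?G = "\<lambda>X h. {F \<in> X \<rightarrow>\<^sub>E C. \<forall>v\<in>V. hits (\<lambda>v. if v \<in> X then F v else h v) U v}"
  let ?u = "card {c \<in> C. hits h U c}" and ?b = "card {c \<in> C. hits h {x} c}"
  define n k where "n = card C" and "k = card X"
  have x: "h x = x" "x \<in> V" "x \<notin> U" using insert.prems by auto
  \<comment> \<open>Split by the image \<open>y\<close> of \<open>x\<close>: the choice moves into
    the fixed part as \<open>h(x := y)\<close>, and the remaining function lives on
    \<open>X\<close>.\<close>
  have "card (?G (insert x X) h) = card (\<Union>y\<in>C. (\<lambda>F. F(x := y)) ` ?G X (h(x := y)))"
  proof (rule arg_cong[where f = card], intro equalityI subsetI)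
    fix F assume F: "F \<in> ?G (insert x X) h"
    have e: "(\<lambda>v. if v \<in> X then (F(x := undefined)) v else (h(x := F x)) v) =
      (\<lambda>v. if v \<in> insert x X then F v else h v)"
      using insert.hyps by auto
    have "F(x := undefined) \<in> ?G X (h(x := F x))"
      unfolding mem_Collect_eq e using F insert.hyps by (auto simp: PiE_iff extensional_def)
    moreover have "F = (F(x := undefined))(x := F x)" "F x \<in> C" using F by auto
    ultimately show "F \<in> (\<Union>y\<in>C. (\<lambda>F. F(x := y)) ` ?G X (h(x := y)))" by blast
  next
    fix F assume "F \<in> (\<Union>y\<in>C. (\<lambda>F. F(x := y)) ` ?G X (h(x := y)))"
    then obtain y G where y: "y \<in> C" "G \<in> ?G X (h(x := y))" "F = G(x := y)" by auto
    have "(\<lambda>v. if v \<in> insert x X then F v else h v) =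
      (\<lambda>v. if v \<in> X then G v else (h(x := y)) v)"
      using insert.hyps y(3) by auto
    then show "F \<in> ?G (insert x X) h"
      using y by (auto simp: PiE_iff extensional_def simp del: fun_upd_apply) (auto)
  qed
  also have "\<dots> = (\<Sum>y\<in>C. card (?G X (h(x := y))))"
  proof (subst card_UN_disjoint)
    have fin: "finite (X \<rightarrow>\<^sub>E C)" using insert.hyps assms(2) by (auto intro: finite_PiE)
    then show "\<forall>y\<in>C. finite ((\<lambda>F. F(x := y)) ` ?G X (h(x := y)))" by auto
    show "\<forall>i\<in>C. \<forall>j\<in>C. i \<noteq> j \<longrightarrow> (\<lambda>F. F(x := i)) ` ?G X (h(x := i)) \<inter>
      (\<lambda>F. F(x := j)) ` ?G X (h(x := j)) = {}"
      by (auto simp: fun_eq_iff) metis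
    have "inj_on (\<lambda>F. F(x := y)) (X \<rightarrow>\<^sub>E C)" for y
    proof (rule inj_onI)
      fix F G assume "F \<in> X \<rightarrow>\<^sub>E C" "G \<in> X \<rightarrow>\<^sub>E C" "F(x := y) = G(x := y)"
      then show "F = G" using insert.hyps
        by (metis PiE_arb fun_upd_idem fun_upd_upd)
    qed
    then have "inj_on (\<lambda>F. F(x := y)) (?G X (h(x := y)))" for y
      by (rule inj_on_subset) auto
    then show "(\<Sum>y\<in>C. card ((\<lambda>F. F(x := y)) ` ?G X (h(x := y)))) =
      (\<Sum>y\<in>C. card (?G X (h(x := y))))"
      by (intro sum.cong refl card_image)
  qed (rule assms(2))
  finally have "card C * card (?G (insert x X) h) = (\<Sum>y\<in>C. card C * card (?G X (h(x := y))))"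
    by (simp add: sum_distrib_left)
  also have "\<dots> = (\<Sum>y\<in>C. (if hits h {x} y then 0 else if hits h U y then ?u + ?b else ?u) * n ^ k)"
  proof (rule sum.cong[OF refl])
    fix y assume y: "y \<in> C"
    show "card C * card (?G X (h(x := y))) =
      (if hits h {x} y then 0 else if hits h U y then ?u + ?b else ?u) * n ^ k"
    proof (cases "hits h {x} y")
      case True
      \<comment> \<open>Sending \<open>x\<close> to a point that leads to \<open>x\<close> closes a
        cycle: the points leading to \<open>x\<close> then form a closed set that misses
        \<open>U\<close>.\<close>
      have "\<not> hits (\<lambda>v. if v \<in> X then F v else (h(x := y)) v) U x" for F
      proof (rule not_hits_if_closed[where Z = "{v. hits h {x} v}"])
        have "\<not> hits h {x} v" if "v \<in> X \<union> U" for v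
          using that insert.hyps insert.prems hits_fixpoint_iff[of h v "{x}"] by auto
        then show "{v. hits h {x} v} \<inter> U = {}"
          and "\<And>z. z \<in> {v. hits h {x} v} \<Longrightarrow>
            (if z \<in> X then F z else (h(x := y)) z) \<in> {v. hits h {x} v}"
          using True by (auto intro: hits_stepD)
        show "x \<in> {v. hits h {x} v}" by (auto intro: hits_base)
      qed
      then have empty: "?G X (h(x := y)) = {}" using x by auto
      show ?thesis unfolding empty using True by simp
    next
      case False
      have y_hits: "hits h (U \<union> X) y"
        using insert.prems(4)[of y] y False insert.prems(1) hits_Un_iff[of h "U \<union> X" "{x}" y]
        by auto
      \<comment> \<open>The walk from \<open>y\<close> never meets \<open>x\<close>, so redirecting
        \<open>x\<close> does not affect it.\<close>
      have at_x: "hits (h(x := y)) Y x \<longleftrightarrow> hits h Y y" if "x \<notin> Y" for Y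
        using that hits_fun_upd_iff[of h x y Y y] x False hits_step[of "h(x := y)" Y x]
          hits_stepD[of "h(x := y)" Y x] by auto
      have iff: "hits (h(x := y)) Y v \<longleftrightarrow> hits h Y v \<or> hits h {x} v \<and> hits h Y y" if "x \<notin> Y" for Y v
        using hits_fun_upd_iff[of h x y Y v] x at_x[OF that] by auto
      have "card C * card (?G X (h(x := y))) =
        card {c \<in> C. hits (h(x := y)) U c} * card C ^ card X"
      proof (rule insert.IH)
        show "hits (h(x := y)) (U \<union> X) v" if "v \<in> V" for v
          using insert.prems(4)[OF that] y_hits x insert.hyps
            hits_Un_iff[of h "U \<union> X" "{x}" v] by (subst iff) auto
      qed (use insert.prems insert.hyps in auto)
      moreover have "card {c \<in> C. hits (h(x := y)) U c} = (if hits h U y then ?u + ?b else ?u)"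
      proof (cases "hits h U y")
        case True
        have "{c \<in> C. hits (h(x := y)) U c} = {c \<in> C. hits h U c} \<union> {c \<in> C. hits h {x} c}"
          using iff[of U] x True by auto
        moreover have "{c \<in> C. hits h U c} \<inter> {c \<in> C. hits h {x} c} = {}"
          using hits_disjoint_fixpoints[of h U _ "{x}"] insert.prems by auto
        ultimately show ?thesis using True assms(2) by (simp add: card_Un_disjoint)
      qed (use iff[of U] x in auto)
      ultimately show ?thesis using False by (simp add: n_def k_def)
    qed
  qed
  also have "\<dots> = (\<Sum>y\<in>C. if hits h {x} y then 0 else if hits h U y then ?u + ?b else ?u) * n ^ k"
    by (simp add: sum_distrib_right)
  also have "(\<Sum>y\<in>C. if hits h {x} y then 0 else if hits h U y then ?u + ?b else ?u) = ?u * n"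
  proof -
    have dis: "\<not> hits h {x} c" if "hits h U c" for c
      using hits_disjoint_fixpoints[OF that, of "{x}"] insert.prems by auto
    define B D where "B = {c \<in> C. hits h {x} c}" and "D = {c \<in> C. hits h U c}"
    have BD: "finite B" "finite D" "B \<inter> D = {}" "B \<union> D \<subseteq> C"
      using assms(2) dis by (auto simp: B_def D_def)
    have "(\<Sum>y\<in>C. if hits h {x} y then 0 else if hits h U y then ?u + ?b else ?u) =
      (\<Sum>y\<in>C. (if y \<in> D then ?u + ?b else 0) + (if y \<in> C - (B \<union> D) then ?u else 0))"
      using dis by (intro sum.cong refl) (auto simp: B_def D_def)
    also have "\<dots> = card D * (?u + ?b) + card (C - (B \<union> D)) * ?u"
    proof -
      have "(\<Sum>y\<in>C. if y \<in> Y then z else 0) = card Y * z" if "Y \<subseteq> C" for Y and z :: nat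
        using that assms(2) by (simp add: sum.If_cases Int_absorb1)
      from this[of D] this[of "C - (B \<union> D)"] show ?thesis
        using BD(4) by (simp only: sum.distrib) simp
    qed
    also have "card (C - (B \<union> D)) = n - (card B + card D)"
      using BD assms(2) by (simp add: card_Diff_subset card_Un_disjoint n_def)
    also have "card D * (?u + ?b) + (n - (card B + card D)) * ?u = ?u * n"
    proof -
      have "card B + card D \<le> n"
        unfolding n_def using BD assms(2) by (metis card_Un_disjoint card_mono)
      then obtain q where "n = card B + card D + q" using le_Suc_ex by blast
      then show ?thesis unfolding B_def[symmetric] D_def[symmetric] by (simp add: algebra_simps)
    qed
    finally show ?thesis .
  qed
  finally show ?case using insert.hyps by (simp add: n_def k_def)
qed

text \<open>Once the choices outside \<open>X\<close> are fixed, \<open>card_hitting_completions\<close> says that the class \<open>C\<close>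
  contributes the factor \<open>card U / card C\<close>, whatever these choices are. The predicate \<open>Q\<close> carries
  along the event for the levels on the other side of \<open>0\<close>.\<close>

lemma card_hitting_peel:
  assumes "finite W" "finite V" "C \<subseteq> V" "U \<subseteq> C" "C \<noteq> {}" "V - U \<subseteq> W"
    and finA: "\<And>w. w \<in> W \<Longrightarrow> finite (A w)"
    and X: "X = {v \<in> V - U. A v = C}"
    and A: "\<And>v. v \<in> V - U - X \<Longrightarrow> A v \<subseteq> V - C"
    and Q: "\<And>f g. f \<in> Pi\<^sub>E W A \<Longrightarrow> g \<in> Pi\<^sub>E W A \<Longrightarrow>
      (\<And>v. v \<notin> X \<Longrightarrow> f v = g v) \<Longrightarrow> Q f = Q g"
  shows "card C * card {f \<in> Pi\<^sub>E W A. (\<forall>v\<in>V. hits f U v) \<and> Q f} =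
    card U * card {f \<in> Pi\<^sub>E W A. (\<forall>v\<in>V - C. hits f (X - C) v) \<and> Q f}"
proof -
  have XW: "X \<subseteq> W" using X assms(6) by blast
  have fins: "finite X" "finite C"
    using assms(2,3) X by (auto intro: finite_subset)
  have W: "W = X \<union> (W - X)" using XW by auto
  have PiX: "Pi\<^sub>E X A = X \<rightarrow>\<^sub>E C" using X by (intro PiE_cong) auto
  let ?m = "\<lambda>g F v. if v \<in> X then F v else g v"
  have split: "card {f \<in> Pi\<^sub>E W A. P f} =
    (\<Sum>g\<in>Pi\<^sub>E (W - X) A. card {F \<in> X \<rightarrow>\<^sub>E C. P (?m g F)})" for P
    unfolding PiX[symmetric]
    by (subst W, rule card_PiE_Un_filter) (use XW fins finA assms(1) in auto)
  have "card C * card {F \<in> X \<rightarrow>\<^sub>E C. (\<forall>v\<in>V. hits (?m g F) U v) \<and> Q (?m g F)} =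
    card U * card {F \<in> X \<rightarrow>\<^sub>E C. (\<forall>v\<in>V - C. hits (?m g F) (X - C) v) \<and> Q (?m g F)}"
    if g: "g \<in> Pi\<^sub>E (W - X) A" for g
  proof -
    \<comment> \<open>Walks stop at \<open>U\<close> and at the points of \<open>X\<close>, whose
      parents are the ones still to be chosen; all other choices are frozen in
      \<open>g\<close>.\<close>
    define h where "h = (\<lambda>v. if v \<in> X \<union> U then v else g v)"
    have gA: "g v \<in> V - C" if "v \<in> V - U - X" for v
      using that g A[OF that] assms(6) by (auto simp: PiE_iff)
    have hits1: "hits (?m g F) (X - C) v \<longleftrightarrow> hits h (X - C) v" if "v \<in> V - C" for F v
    proof -
      have "?m g F x \<in> V - C" "h x = ?m g F x" if "x \<in> V - C" "x \<notin> X - C" for x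
        using that gA[of x] assms(4) by (auto simp: h_def)
      then show ?thesis
        by (intro iffI; elim hits_cong_on[where R = "V - C"]) (use that in auto)
    qed
    have hits0: "hits (?m g F) U v \<longleftrightarrow> hits (?m h F) U v" for F v
      by (rule hits_cong) (auto simp: h_def)
    \<comment> \<open>\<open>Q\<close> ignores the values on \<open>X\<close>, so any completion
      evaluates it; a constant one exists because \<open>C\<close> is nonempty.\<close>
    obtain c where c: "c \<in> C" using assms(5) by auto
    define Qg where "Qg = Q (?m g (\<lambda>v\<in>X. c))"
    have merge: "?m g F \<in> Pi\<^sub>E W A" if "F \<in> X \<rightarrow>\<^sub>E C" for F
      using that g XW unfolding PiX[symmetric] by (auto simp: PiE_iff extensional_def)
    have Qg: "Q (?m g F) = Qg" if "F \<in> X \<rightarrow>\<^sub>E C" for F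
      unfolding Qg_def using that c by (intro Q merge) auto
    show ?thesis
    proof (cases "Qg \<and> (\<forall>v\<in>V - C. hits h (X - C) v)")
      case True
      have "{c \<in> C. hits h U c} = U"
      proof -
        \<comment> \<open>\<open>V - U\<close> is closed under \<open>h\<close>: points of
          \<open>X\<close> are fixed, and all others move outside \<open>C\<close>, hence outside
          \<open>U\<close>. So the number of points of \<open>C\<close> leading to \<open>U\<close>
          is exactly \<open>card U\<close>.\<close>
        have "\<not> hits h U c" if "c \<in> V - U" for c
          by (rule not_hits_if_closed[where Z = "V - U"])
            (use that gA assms(4) X in \<open>auto simp: h_def\<close>)
        then show ?thesis using assms(3,4) by (auto intro: hits_base)
      qed
      moreover have "card C * card {F \<in> X \<rightarrow>\<^sub>E C. \<forall>v\<in>V. hits (?m h F) U v} =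
        card {c \<in> C. hits h U c} * card C ^ card X"
      proof (rule card_hitting_completions)
        show "hits h (U \<union> X) v" if "v \<in> V" for v
        proof -
          have *: "hits h (U \<union> X) v" if "v \<in> V - C" for v
            using True that by (auto intro: hits_mono)
          show ?thesis
          proof (cases "v \<in> U \<union> X \<or> v \<notin> C")
            case False
            then have "h v = g v" "g v \<in> V - C" using gA that by (auto simp: h_def)
            then show ?thesis using * hits_step by metis
          qed (use * that in \<open>auto intro: hits_base\<close>)
        qed
      qed (use fins X assms(3) in \<open>auto simp: h_def\<close>)
      moreover have "{F \<in> X \<rightarrow>\<^sub>E C. (\<forall>v\<in>V - C. hits (?m g F) (X - C) v) \<and> Q (?m g F)} = X \<rightarrow>\<^sub>E C"
        using True hits1 Qg by auto
      moreover have "card (X \<rightarrow>\<^sub>E C) = card C ^ card X" using fins by (simp add: card_PiE)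
      ultimately show ?thesis using True by (simp add: hits0 Qg cong: conj_cong)
    next
      case False
      \<comment> \<open>Only points of \<open>X\<close> move into \<open>C\<close>, and
        \<open>U\<close> lies in \<open>C\<close>. A walk from outside \<open>C\<close> to
        \<open>U\<close> thus passes through \<open>X - C\<close>, so the first event implies the
        second and both counts are 0 in this case.\<close>
      have "hits (?m g F) (X - C) v" if "hits (?m g F) U v" "v \<in> V - C" for F v
        using that
      proof induction
        case (hits_step v)
        show ?case
        proof (cases "v \<in> X")
          case False
          then have "?m g F v \<in> V - C" using gA[of v] hits_step assms(4) by auto
          then show ?thesis using hits_step.IH by (intro hits.hits_step[of _ _ v])
        qed (use hits_step.prems in \<open>auto intro: hits_base\<close>)
      qed (use assms(4) in auto)
      then have "\<forall>v\<in>V - C. hits h (X - C) v" if "\<forall>v\<in>V. hits (?m g F) U v" for F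
        using that hits1 by blast
      then have "{F \<in> X \<rightarrow>\<^sub>E C. (\<forall>v\<in>V. hits (?m g F) U v) \<and> Q (?m g F)} = {}"
        using False Qg by blast
      moreover have "{F \<in> X \<rightarrow>\<^sub>E C. (\<forall>v\<in>V - C. hits (?m g F) (X - C) v) \<and> Q (?m g F)} = {}"
        using False Qg hits1 by blast
      ultimately show ?thesis by (simp only:) simp
    qed
  qed
  then show ?thesis by (simp add: split sum_distrib_left)
qed

section \<open>Peeling off the levels on both sides of the root\<close>

text \<open>A step lowers the level by at most one, so walks descend into level \<open>k\<close>
  only from level \<open>k + 1\<close>. Peeling off level \<open>k\<close> therefore turns the event
  for \<open>k\<close> into the same event for \<open>k + 1\<close>, and the factors telescope until
  no level is left.\<close>

lemma card_hitting_levels: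
  fixes lev tgt :: "'a \<Rightarrow> int" and r :: int
  assumes fin: "finite W" "finite V" "\<And>w. w \<in> W \<Longrightarrow> finite (A w)"
    and W: "\<And>v. v \<in> V \<Longrightarrow> lev v \<ge> 1 \<Longrightarrow> v \<in> W"
    and A: "\<And>v. v \<in> V \<Longrightarrow> lev v \<ge> 1 \<Longrightarrow> A v = {u \<in> V. lev u = tgt v} \<and> tgt v \<ge> lev v - 1"
    and ne: "\<And>i. 1 \<le> i \<Longrightarrow> i \<le> r \<Longrightarrow> {v \<in> V. lev v = i} \<noteq> {}"
    and le: "\<And>v. v \<in> V \<Longrightarrow> lev v \<le> r"
    and Q: "\<And>f g. f \<in> Pi\<^sub>E W A \<Longrightarrow> g \<in> Pi\<^sub>E W A \<Longrightarrow>
      (\<And>v. \<not> (v \<in> V \<and> lev v \<ge> 1) \<Longrightarrow> f v = g v) \<Longrightarrow> Q f = Q g"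
    and "1 \<le> k"
  shows "(\<Prod>i = k..r. card {v \<in> V. lev v = i}) *
      card {f \<in> Pi\<^sub>E W A. (\<forall>v\<in>{v \<in> V. lev v \<ge> k}. hits f {v \<in> V. lev v = k \<and> tgt v = k - 1} v) \<and> Q f} =
    (\<Prod>i = k..r. card {v \<in> V. lev v = i \<and> tgt v = i - 1}) * card {f \<in> Pi\<^sub>E W A. Q f}"
  using \<open>1 \<le> k\<close>
proof (induction "nat (r + 1 - k)" arbitrary: k)
  case 0
  then have "k > r" by simp
  then have "{v \<in> V. lev v \<ge> k} = {}" "{k..r} = {}" using le by fastforce+
  then show ?case by (simp only:) simp
next
  case (Suc d)
  let ?L = "\<lambda>i. {v \<in> V. lev v = i}" and ?M = "\<lambda>i. {v \<in> V. lev v = i \<and> tgt v = i - 1}"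
  let ?E = "\<lambda>k. card {f \<in> Pi\<^sub>E W A. (\<forall>v\<in>{v \<in> V. lev v \<ge> k}. hits f (?M k) v) \<and> Q f}"
  let ?V = "{v \<in> V. lev v \<ge> k}"
  define X where "X = {v \<in> ?V - ?M k. A v = ?L k}"
  have k: "k \<le> r" "1 \<le> k" using Suc by auto
  obtain u where u: "u \<in> V" "lev u = k" using ne[OF k(2,1)] by auto
  \<comment> \<open>Level \<open>k\<close> is nonempty, so the set of admissible parents determines
    the target.\<close>
  have "A v = ?L k \<longleftrightarrow> tgt v = k" if "v \<in> V" "lev v \<ge> k" for v
  proof
    assume "A v = ?L k"
    then have "u \<in> A v" using u by blast
    then show "tgt v = k" using A[of v] that k u(2) by auto
  qed (use A[of v] that k in auto)
  then have X: "X = {v \<in> V. lev v \<ge> k \<and> tgt v = k}" unfolding X_def by auto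
  have "card (?L k) * card {f \<in> Pi\<^sub>E W A. (\<forall>v\<in>?V. hits f (?M k) v) \<and> Q f} =
    card (?M k) * card {f \<in> Pi\<^sub>E W A. (\<forall>v\<in>?V - ?L k. hits f (X - ?L k) v) \<and> Q f}"
  proof (rule card_hitting_peel[OF _ _ _ _ _ _ _ X_def])
    show "A v \<subseteq> ?V - ?L k" if "v \<in> ?V - ?M k - X" for v
    proof -
      have v: "v \<in> V" "lev v \<ge> k" "v \<notin> ?M k" "tgt v \<noteq> k" using that by (auto simp: X)
      moreover have "A v = ?L (tgt v)" "tgt v \<ge> lev v - 1" using A[of v] v k by auto
      ultimately show ?thesis by auto
    qed
    show "Q f = Q g" if "f \<in> Pi\<^sub>E W A" "g \<in> Pi\<^sub>E W A" "\<And>v. v \<notin> X \<Longrightarrow> f v = g v" for f g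
      by (rule Q, fact, fact, rule that) (use k in \<open>auto simp: X\<close>)
    show "?L k \<noteq> {}" using ne k by blast
  qed (use fin W k in auto)
  moreover have "?V - ?L k = {v \<in> V. lev v \<ge> k + 1}" by auto
  moreover have "X - ?L k = ?M (k + 1)"
  proof -
    \<comment> \<open>The bound \<open>tgt v \<ge> lev v - 1\<close> leaves no other level above
      \<open>k\<close> from which level \<open>k\<close> can be entered.\<close>
    have "lev v = k + 1" if "v \<in> V" "lev v \<ge> k" "lev v \<noteq> k" "tgt v = k" for v
      using A[of v] that k by auto
    note lev = this
    show ?thesis
    proof (intro equalityI subsetI)
      fix v assume "v \<in> X - ?L k"
      then show "v \<in> ?M (k + 1)" using lev[of v] by (auto simp: X)
    qed (auto simp: X)
  qed
  ultimately have step: "card (?L k) * ?E k = card (?M k) * ?E (k + 1)" by simp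
  have IH: "(\<Prod>i = k+1..r. card (?L i)) * ?E (k + 1) =
    (\<Prod>i = k+1..r. card (?M i)) * card {f \<in> Pi\<^sub>E W A. Q f}"
    using Suc.hyps(1)[of "k + 1"] Suc.hyps(2) k by simp
  have "{k..r} = insert k {k+1..r}" using k by auto
  then have prods: "(\<Prod>i = k..r. F i) = F k * (\<Prod>i = k+1..r. F i)" for F :: "int \<Rightarrow> nat"
    using k
    by (metis atLeastAtMost_iff finite_atLeastAtMost_int less_irrefl prod.insert zless_add1_eq
        not_less add1_zle_eq)
  have "(a * p) * e = (b * q) * t" if "a * e = b * e'" "p * e' = q * t" for a b p q e e' t :: nat
  proof -
    have "(a * p) * e = p * (a * e)" by simp
    also have "\<dots> = b * (p * e')" by (simp add: that(1))
    finally show ?thesis by (simp add: that(2))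
  qed
  from this[OF step IH] show ?case unfolding prods .
qed

text \<open>Peeling off level 0 with \<open>U = {\<rho>}\<close> leaves an event about the other
  levels. No walk crosses 0 without landing on it, so this event is a conjunction of one for each
  side; \<open>card_hitting_levels\<close> is applied to the positive side with the negative event
  as \<open>Q\<close>, then to the negated levels.\<close>

lemma card_parent_functions:
  fixes lev tgt :: "'a \<Rightarrow> int" and l r :: int
  assumes V: "finite V" "\<rho> \<in> V" "lev \<rho> = 0"
    and A: "\<And>v. v \<in> V - {\<rho>} \<Longrightarrow> A v = {u \<in> V. lev u = tgt v}"
    and pos: "\<And>v. v \<in> V \<Longrightarrow> lev v > 0 \<Longrightarrow> tgt v \<ge> lev v - 1"
    and neg: "\<And>v. v \<in> V \<Longrightarrow> lev v < 0 \<Longrightarrow> tgt v \<le> lev v + 1"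
    and ne: "\<And>i. l \<le> i \<Longrightarrow> i \<le> r \<Longrightarrow> {v \<in> V. lev v = i} \<noteq> {}"
    and le: "\<And>v. v \<in> V \<Longrightarrow> l \<le> lev v \<and> lev v \<le> r"
  shows "(\<Prod>i = l..r. card {v \<in> V. lev v = i}) *
      card {f \<in> Pi\<^sub>E (V - {\<rho>}) A. \<forall>v\<in>V. hits f {\<rho>} v} =
    (\<Prod>i = l..-1. card {v \<in> V. lev v = i \<and> tgt v = i + 1}) *
    (\<Prod>i = 1..r. card {v \<in> V. lev v = i \<and> tgt v = i - 1}) *
    (\<Prod>v\<in>V - {\<rho>}. card {u \<in> V. lev u = tgt v})"
proof -
  let ?L = "\<lambda>i. {v \<in> V. lev v = i}" and ?P = "Pi\<^sub>E (V - {\<rho>}) A"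
  \<comment> \<open>The unreduced \<open>1 - 1\<close> and the negated levels make these sets
    literal instances of \<open>card_hitting_levels\<close> at \<open>k = 1\<close>.\<close>
  let ?R = "{v \<in> V. lev v \<ge> 1}" and ?U = "{v \<in> V. lev v = 1 \<and> tgt v = 1 - 1}"
  let ?R' = "{v \<in> V. - lev v \<ge> 1}" and ?U' = "{v \<in> V. - lev v = 1 \<and> - tgt v = 1 - 1}"
  define X where "X = {v \<in> V - {\<rho>}. A v = ?L 0}"
  have lr: "l \<le> 0" "0 \<le> r" using le[OF V(2)] V(3) by auto
  have finA: "finite (A v)" if "v \<in> V - {\<rho>}" for v using A[OF that] V(1) by auto
  have "A v = ?L 0 \<longleftrightarrow> tgt v = 0" if "v \<in> V - {\<rho>}" for v
  proof
    assume "A v = ?L 0"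
    then have "\<rho> \<in> A v" using V by blast
    then show "tgt v = 0" using A[OF that] V(3) by auto
  qed (use A[OF that] in auto)
  then have X: "X = {v \<in> V - {\<rho>}. tgt v = 0}" unfolding X_def by auto
  have "card (?L 0) * card {f \<in> ?P. (\<forall>v\<in>V. hits f {\<rho>} v) \<and> True} =
    card {\<rho>} * card {f \<in> ?P. (\<forall>v\<in>V - ?L 0. hits f (X - ?L 0) v) \<and> True}"
  proof (rule card_hitting_peel[OF _ _ _ _ _ _ _ X_def])
    show "A v \<subseteq> V - ?L 0" if "v \<in> V - {\<rho>} - X" for v
      using that A[of v] by (auto simp: X)
  qed (use V finA in auto)
  moreover have "(\<forall>v\<in>V - ?L 0. hits f (X - ?L 0) v) \<longleftrightarrow>
      (\<forall>v\<in>?R. hits f ?U v) \<and> (\<forall>v\<in>?R'. hits f ?U' v)" if f: "f \<in> ?P" for f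
  proof -
    have fv: "f v \<in> V \<and> lev (f v) = tgt v" if "v \<in> V - {\<rho>}" for v
      using f A[OF that] that by (auto simp: PiE_iff)
    have "lev v = 1 \<or> lev v = - 1" if "v \<in> V" "lev v \<noteq> 0" "tgt v = 0" for v
      using pos[of v] neg[of v] that by linarith
    note lev = this
    have XU: "X - ?L 0 = ?U \<union> ?U'"
    proof (intro equalityI subsetI)
      fix v assume "v \<in> X - ?L 0"
      then show "v \<in> ?U \<union> ?U'" using lev[of v] by (auto simp: X)
    qed (use V(3) in \<open>auto simp: X\<close>)
    \<comment> \<open>A positive vertex outside \<open>X\<close> has a nonzero target that is at
      least \<open>lev v - 1 \<ge> 0\<close>, so the walk stays positive until it meets
      \<open>X\<close>; the negative side is symmetric.\<close>
    have "hits f ?U v" if "hits f (X - ?L 0) v" "v \<in> ?R" for v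
      using that
    proof induction
      case (hits_step v)
      show ?case
      proof (cases "v \<in> X")
        case False
        moreover have "v \<noteq> \<rho>" using hits_step.prems V(3) by auto
        ultimately have "f v \<in> ?R" using hits_step.prems fv[of v] pos[of v] by (auto simp: X)
        then show ?thesis using hits_step.IH by (intro hits.hits_step[of _ _ v])
      qed (use hits_step.prems pos[of v] in \<open>auto intro!: hits_base simp: X\<close>)
    qed (auto intro!: hits_base simp: XU)
    moreover have "hits f ?U' v" if "hits f (X - ?L 0) v" "v \<in> ?R'" for v
      using that
    proof induction
      case (hits_step v)
      show ?case
      proof (cases "v \<in> X")
        case False
        moreover have "v \<noteq> \<rho>" using hits_step.prems V(3) by auto
        ultimately have "f v \<in> ?R'" using hits_step.prems fv[of v] neg[of v] by (auto simp: X)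
        then show ?thesis using hits_step.IH by (intro hits.hits_step[of _ _ v])
      qed (use hits_step.prems neg[of v] in \<open>auto intro!: hits_base simp: X\<close>)
    qed (auto intro!: hits_base simp: XU)
    moreover have "V - ?L 0 = ?R \<union> ?R'" by auto
    ultimately show ?thesis unfolding XU by (auto simp: hits_Un_iff)
  qed
  ultimately have zero: "card (?L 0) * card {f \<in> ?P. \<forall>v\<in>V. hits f {\<rho>} v} =
    card {f \<in> ?P. (\<forall>v\<in>?R. hits f ?U v) \<and> (\<forall>v\<in>?R'. hits f ?U' v)}"
    by (simp cong: conj_cong)
  have A0: "A v = {u \<in> V. lev u = tgt v}" if "v \<in> V" "lev v \<noteq> 0" for v
    using A[of v] that V(3) by auto
  have up: "(\<Prod>i = 1..r. card (?L i)) *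
      card {f \<in> ?P. (\<forall>v\<in>?R. hits f ?U v) \<and> (\<forall>v\<in>?R'. hits f ?U' v)} =
    (\<Prod>i = 1..r. card {v \<in> V. lev v = i \<and> tgt v = i - 1}) *
      card {f \<in> ?P. \<forall>v\<in>?R'. hits f ?U' v}"
  proof (rule card_hitting_levels)
    \<comment> \<open>Until it meets \<open>?U'\<close>, a walk from \<open>?R'\<close> stays in
      \<open>?R'\<close>. The negative event thus ignores the choices at positive levels, as is
      required of \<open>Q\<close>.\<close>
    have "hits g ?U' v" if "f \<in> ?P" "\<And>v. \<not> (v \<in> V \<and> lev v \<ge> 1) \<Longrightarrow> f v = g v"
      "v \<in> ?R'" "hits f ?U' v" for f g v
    proof (rule hits_cong_on[OF that(4,3)])
      fix v assume v: "v \<in> ?R'" "v \<notin> ?U'"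
      then have "v \<in> V - {\<rho>}" using V(3) by auto
      then have "f v \<in> {u \<in> V. lev u = tgt v}"
        using that(1) A by (metis PiE_mem)
      then show "f v \<in> ?R' \<and> g v = f v" using v neg[of v] that(2)[of v] by auto
    qed
    note transfer = this
    show "(\<forall>v\<in>?R'. hits f ?U' v) = (\<forall>v\<in>?R'. hits g ?U' v)"
      if "f \<in> ?P" "g \<in> ?P" and fg: "\<And>v. \<not> (v \<in> V \<and> lev v \<ge> 1) \<Longrightarrow> f v = g v" for f g
      using transfer[OF that(1) fg] transfer[OF that(2) fg[symmetric]] by blast
    show "A v = {u \<in> V. lev u = tgt v} \<and> lev v - 1 \<le> tgt v" if "v \<in> V" "1 \<le> lev v" for v
      using A0[of v] pos[of v] that by simp
  qed (use V finA ne le lr in auto)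
  have down: "(\<Prod>i = 1..-l. card {v \<in> V. - lev v = i}) *
      card {f \<in> ?P. (\<forall>v\<in>?R'. hits f ?U' v) \<and> True} =
    (\<Prod>i = 1..-l. card {v \<in> V. - lev v = i \<and> - tgt v = i - 1}) * card {f \<in> ?P. True}"
  proof (rule card_hitting_levels)
    show "{v \<in> V. - lev v = i} \<noteq> {}" if "1 \<le> i" "i \<le> - l" for i
    proof -
      have "- lev v = i \<longleftrightarrow> lev v = - i" for v by auto
      then show ?thesis using ne[of "- i"] that lr by auto
    qed
    show "A v = {u \<in> V. - lev u = - tgt v} \<and> - lev v - 1 \<le> - tgt v"
      if "v \<in> V" "1 \<le> - lev v" for v
      using A0[of v] neg[of v] that by simp
  qed (use V finA le lr in auto)
  have "(\<Prod>i = 1..-l. F i) = (\<Prod>i = l..-1. F (- i))" for F :: "int \<Rightarrow> nat"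
    by (rule prod.reindex_bij_witness[of _ uminus uminus]) auto
  note reflect = this
  have "- x = - i - 1 \<longleftrightarrow> x = i + 1" for x i :: int by auto
  with down[unfolded reflect] have down': "(\<Prod>i = l..-1. card (?L i)) * card {f \<in> ?P. \<forall>v\<in>?R'. hits f ?U' v} =
    (\<Prod>i = l..-1. card {v \<in> V. lev v = i \<and> tgt v = i + 1}) * card ?P"
    by (simp only: neg_equal_iff_equal simp_thms Collect_mem_eq)
  have levels: "(\<Prod>i = l..r. card (?L i)) =
    (\<Prod>i = l..-1. card (?L i)) * ((\<Prod>i = 1..r. card (?L i)) * card (?L 0))"
  proof -
    have "{l..r} = {l..-1} \<union> ({1..r} \<union> {0})" using lr by auto
    then show ?thesis by (simp add: prod.union_disjoint)
  qed
  have "card ?P = (\<Prod>v\<in>V - {\<rho>}. card {u \<in> V. lev u = tgt v})"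
    using V(1) A by (simp add: card_PiE)
  moreover have "p * (q * a) * e = s * t * g" if "a * e = x" "q * x = t * y" "p * y = s * g"
    for a e g p q s t x y :: nat
  proof -
    have "p * (q * a) * e = p * (q * (a * e))" by simp
    also have "\<dots> = t * (p * y)" by (simp add: that)
    finally show ?thesis by (simp add: that)
  qed
  note this[OF zero up down']
  ultimately show ?thesis unfolding levels by (simp only:)
qed

section \<open>Trees and parent functions\<close>

lemma is_walk_Cons: "is_walk E (x # xs) \<longleftrightarrow> xs = [] \<or> {x, hd xs} \<in> E \<and> is_walk E xs"
  by (cases xs) (auto simp: is_walk_def)

lemma is_walk_append:
  assumes "xs \<noteq> []" "ys \<noteq> []"
  shows "is_walk E (xs @ ys) \<longleftrightarrow> is_walk E xs \<and> is_walk E ys \<and> {last xs, hd ys} \<in> E"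
  using assms by (auto simp: is_walk_def successively_append_iff)

lemma is_walk_rev: "is_walk E xs \<Longrightarrow> is_walk E (rev xs)"
  by (auto simp: is_walk_def insert_commute)

lemma is_walk_mono: "is_walk E xs \<Longrightarrow> E \<subseteq> E' \<Longrightarrow> is_walk E' xs"
  by (auto simp: is_walk_def elim!: successively_mono)

text \<open>Cutting out the stretch between two visits to the same vertex shortens the walk and
  keeps its ends.\<close>

lemma is_walk_imp_path:
  assumes "is_walk E xs"
  obtains ys where "is_path E ys" "hd ys = hd xs" "last ys = last xs"
proof -
  have "\<exists>ys. is_path E ys \<and> hd ys = hd xs \<and> last ys = last xs"
    using assms
  proof (induction "length xs" arbitrary: xs rule: less_induct)
    case less
    show ?case
    proof (cases "distinct xs")
      case False
      then obtain as y bs cs where xs: "xs = as @ [y] @ bs @ [y] @ cs"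
        using not_distinct_decomp by blast
      let ?ys = "as @ [y] @ cs"
      have "successively (\<lambda>u v. {u, v} \<in> E) ?ys"
        using less.prems unfolding xs is_walk_def
        by (auto simp: successively_append_iff successively_Cons)
      then have "is_walk E ?ys" by (simp add: is_walk_def)
      moreover have "hd ?ys = hd xs" "last ?ys = last xs" "length ?ys < length xs"
        unfolding xs by (simp_all add: hd_append)
      ultimately show ?thesis using less.hyps by metis
    qed (use less.prems in \<open>auto simp: is_path_def\<close>)
  qed
  then show ?thesis using that by blast
qed

section \<open>From parent functions to trees\<close>

definition parent_edges :: "'a set \<Rightarrow> 'a \<Rightarrow> ('a \<Rightarrow> 'a) \<Rightarrow> 'a set set" where
  "parent_edges V \<rho> f = (\<lambda>v. {v, f v}) ` (V - {\<rho>})"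

text \<open>The depth, that is, the number of steps to the root, drops along \<open>f\<close>. This
  rules out loops, repeated vertices and cycles below. No equation is asked at the root, where
  \<open>f\<close> is arbitrary.\<close>

lemma hits_depth:
  assumes "\<And>v. v \<in> V \<Longrightarrow> hits f {\<rho>} v" "f \<in> V - {\<rho>} \<rightarrow> V"
  obtains d :: "'a \<Rightarrow> nat" where "\<And>v. v \<in> V - {\<rho>} \<Longrightarrow> d v = Suc (d (f v))"
proof
  let ?d = "\<lambda>v. LEAST k. (f ^^ k) v = \<rho>"
  fix v assume v: "v \<in> V - {\<rho>}"
  have "hits f {\<rho>} v" using assms v by auto
  then obtain k where "(f ^^ k) v = \<rho>"
  proof (induction arbitrary: thesis)
    case (hits_base v)
    then show ?case by (metis funpow_0 singletonD)
  next
    case (hits_step v)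
    then show ?case by (metis comp_apply funpow_Suc_right)
  qed
  then have "?d v = Suc (LEAST k. (f ^^ Suc k) v = \<rho>)"
    using v by (intro Least_Suc) auto
  then show "?d v = Suc (?d (f v))" by (simp add: funpow_swap1)
qed

context
  fixes V :: "'a set" and \<rho> :: 'a and f :: "'a \<Rightarrow> 'a" and E
  assumes root: "\<rho> \<in> V" and f: "f \<in> V - {\<rho>} \<rightarrow> V"
    and hits: "\<And>v. v \<in> V \<Longrightarrow> hits f {\<rho>} v"
    and E: "E = parent_edges V \<rho> f"
begin

lemma parent_edges_iff:
  "{u, v} \<in> E \<longleftrightarrow> u \<in> V - {\<rho>} \<and> f u = v \<or> v \<in> V - {\<rho>} \<and> f v = u"
  unfolding E parent_edges_def by (auto simp: doubleton_eq_iff)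

lemma path_from_root:
  assumes "v \<in> V"
  shows "\<exists>xs. is_path E (xs @ [v]) \<and> hd (xs @ [v]) = \<rho> \<and> (v \<noteq> \<rho> \<longrightarrow> xs \<noteq> [] \<and> last xs = f v)"
proof -
  obtain d :: "'a \<Rightarrow> nat" where d: "\<And>v. v \<in> V - {\<rho>} \<Longrightarrow> d v = Suc (d (f v))"
    using hits_depth[OF hits f] by blast
  \<comment> \<open>The induction also carries that all earlier vertices have smaller depth than the
    end, which keeps the extended path distinct.\<close>
  from hits[OF assms] assms
  have "\<exists>xs. is_path E (xs @ [v]) \<and> hd (xs @ [v]) = \<rho> \<and> (\<forall>x\<in>set xs. d x < d v) \<and>
    (v \<noteq> \<rho> \<longrightarrow> xs \<noteq> [] \<and> last xs = f v)"
  proof induction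
    case (hits_base v)
    then show ?case by (intro exI[of _ "[]"]) (auto simp: is_path_def is_walk_def)
  next
    case (hits_step v)
    show ?case
    proof (cases "v = \<rho>")
      case True
      then show ?thesis by (intro exI[of _ "[]"]) (auto simp: is_path_def is_walk_def)
    next
      case False
      then have v: "v \<in> V - {\<rho>}" "f v \<in> V" using hits_step f by auto
      then obtain xs where xs: "is_path E (xs @ [f v])" "hd (xs @ [f v]) = \<rho>"
        "\<forall>x\<in>set xs. d x < d (f v)" using hits_step by blast
      have "is_walk E [v]" "{f v, v} \<in> E" using v by (auto simp: is_walk_Cons parent_edges_iff)
      then have "is_walk E ((xs @ [f v]) @ [v])"
        using xs(1) by (subst is_walk_append) (simp_all add: is_path_def)
      moreover have "v \<noteq> f v" using d[OF v(1)] by (metis n_not_Suc_n)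
      moreover have "v \<notin> set xs" using xs(3) d[OF v(1)] by (metis lessI less_asym)
      moreover have "distinct (xs @ [f v])" using xs(1) by (simp add: is_path_def)
      ultimately have "is_path E ((xs @ [f v]) @ [v])"
        unfolding is_path_def by simp
      moreover have "\<forall>x\<in>set (xs @ [f v]). d x < d v"
        unfolding d[OF v(1)] using xs(3) by auto
      ultimately show ?thesis using xs(2)
        by (intro exI[of _ "xs @ [f v]"]) (auto simp: hd_append split: if_splits)
    qed
  qed
  then show ?thesis by blast
qed

text \<open>A path from the root can only descend: the root has no parent, and after a step from
  \<open>x\<close> down to \<open>v\<close> the only way up is back to \<open>x\<close>, which
  distinctness forbids.\<close>

lemma step_from_root:
  assumes "is_path E (xs @ [v, w])" "hd (xs @ [v, w]) = \<rho>"
  shows "w \<in> V - {\<rho>} \<and> f w = v"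
  using assms
proof (induction xs arbitrary: v w rule: rev_induct)
  case Nil
  then show ?case by (auto simp: is_path_def is_walk_Cons parent_edges_iff)
next
  case (snoc x xs)
  have "{v, w} \<in> E" "is_path E (xs @ [x, v])" "x \<noteq> w"
    using snoc.prems by (auto simp: is_path_def is_walk_def successively_append_iff)
  moreover have "f v = x" using snoc calculation by (auto simp: hd_append)
  ultimately show ?case by (auto simp: parent_edges_iff)
qed

lemma is_child_parent_edges_iff: "is_child E \<rho> w v \<longleftrightarrow> w \<in> V - {\<rho>} \<and> f w = v"
proof
  assume "is_child E \<rho> w v"
  then show "w \<in> V - {\<rho>} \<and> f w = v" using step_from_root by (auto simp: is_child_def)
next
  assume w: "w \<in> V - {\<rho>} \<and> f w = v"
  then obtain xs where xs: "is_path E (xs @ [w])" "hd (xs @ [w]) = \<rho>" "xs \<noteq> []" "last xs = v"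
    using path_from_root[of w] by auto
  then have "xs @ [w] = butlast xs @ [v, w]" using append_butlast_last_id[of xs] by simp
  then show "is_child E \<rho> w v" using xs unfolding is_child_def by metis
qed

text \<open>Any two vertices are joined through the root. On a cycle, both neighbours of a deepest
  vertex would have to be its parent, but they are distinct.\<close>

lemma is_tree_parent_edges: "is_tree V E"
proof -
  obtain d :: "'a \<Rightarrow> nat" where d: "\<And>v. v \<in> V - {\<rho>} \<Longrightarrow> d v = Suc (d (f v))"
    using hits_depth[OF hits f] by blast
  have simple: "simple_graph V E"
    unfolding simple_graph_def
  proof
    fix e assume "e \<in> E"
    then obtain v where v: "v \<in> V - {\<rho>}" "e = {v, f v}" by (auto simp: E parent_edges_def)
    moreover have "v \<noteq> f v" using d[OF v(1)] by (metis n_not_Suc_n)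
    ultimately have "f v \<in> V" "v \<noteq> f v" using f by auto
    then show "e \<subseteq> V \<and> card e = 2" using v by auto
  qed
  have "connected_graph V E"
    unfolding connected_graph_def
  proof (intro ballI)
    fix u v assume "u \<in> V" "v \<in> V"
    have walk: "\<exists>xs. is_walk E (\<rho> # xs) \<and> last (\<rho> # xs) = v" if v: "v \<in> V" for v
    proof -
      obtain xs where xs: "is_walk E (xs @ [v])" "hd (xs @ [v]) = \<rho>"
        using path_from_root[OF v] unfolding is_path_def by blast
      then have "xs @ [v] = \<rho> # tl (xs @ [v])" by (metis append_is_Nil_conv hd_Cons_tl not_Cons_self2)
      then show ?thesis using xs(1) by (metis last_snoc)
    qed
    obtain xs where xs: "is_walk E (\<rho> # xs)" "last (\<rho> # xs) = u" using walk \<open>u \<in> V\<close> by blast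
    obtain ys where ys: "is_walk E (\<rho> # ys)" "last (\<rho> # ys) = v" using walk \<open>v \<in> V\<close> by blast
    have "is_walk E (rev (\<rho> # xs) @ ys)"
    proof (cases "ys = []")
      case False
      then show ?thesis using ys is_walk_rev[OF xs(1)] is_walk_append[of "rev (\<rho> # xs)" ys E]
        by (simp add: is_walk_Cons)
    qed (use is_walk_rev[OF xs(1)] in simp)
    moreover have "last (rev (\<rho> # xs) @ ys) = v" using ys(2) by (cases "ys = []") auto
    moreover have "hd (rev (\<rho> # xs) @ ys) = u"
      using xs(2) by (auto simp: hd_append hd_rev)
    ultimately show "\<exists>ws. is_walk E ws \<and> hd ws = u \<and> last ws = v" by blast
  qed
  moreover have "\<not> is_cycle E xs" for xs
  proof
    assume c: "is_cycle E xs"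
    define L where "L = length xs"
    have L: "3 \<le> L" "distinct xs" using c by (auto simp: is_cycle_def is_path_def L_def)
    have next_edge: "{xs ! i, xs ! (Suc i mod L)} \<in> E" if "i < L" for i
    proof (cases "Suc i = L")
      case True
      have "xs \<noteq> []" using L by (auto simp: L_def)
      moreover have "length xs - 1 = i" using True by (simp add: L_def)
      ultimately have "last xs = xs ! i" "hd xs = xs ! 0"
        by (simp_all add: last_conv_nth hd_conv_nth)
      then show ?thesis using True c by (simp add: is_cycle_def)
    next
      case False
      then show ?thesis using that c
        by (auto simp: is_cycle_def is_path_def is_walk_def successively_conv_nth L_def)
    qed
    obtain i where i: "i < L" "\<And>j. j < L \<Longrightarrow> d (xs ! j) \<le> d (xs ! i)"
    proof -
      let ?D = "(\<lambda>j. d (xs ! j)) ` {..<L}"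
      have "finite ?D" "?D \<noteq> {}" using L by (auto simp: lessThan_empty_iff)
      then have "Max ?D \<in> ?D" by (rule Max_in)
      then obtain i where i: "i < L" "Max ?D = d (xs ! i)" by blast
      have "d (xs ! j) \<le> d (xs ! i)" if "j < L" for j
        unfolding i(2)[symmetric] using that by (intro Max_ge) auto
      then show ?thesis using that i(1) by blast
    qed
    \<comment> \<open>The cyclic predecessor and successor of \<open>i\<close>; adding
      \<open>L\<close> first keeps the natural subtraction exact at \<open>i = 0\<close>. They
      differ because \<open>L \<ge> 3\<close>.\<close>
    let ?p = "(i + L - 1) mod L" and ?s = "Suc i mod L"
    have ps: "?p < L" "?s < L" "Suc ?p mod L = i"
      using i(1) L(1) by (auto simp: mod_Suc_eq)
    have "?p \<noteq> ?s"
    proof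
      assume "?p = ?s"
      then have "i = Suc (Suc i) mod L" using ps(3) by (simp add: mod_Suc_eq)
      then show False using i(1) L(1) by (auto simp: mod_if split: if_splits)
    qed
    then have ne: "xs ! ?p \<noteq> xs ! ?s" using L ps by (simp add: nth_eq_iff_index_eq L_def)
    have up: "f (xs ! i) = y" if "{xs ! i, y} \<in> E" "d y \<le> d (xs ! i)" for y
      using that d[of y] by (auto simp: parent_edges_iff)
    have "f (xs ! i) = xs ! ?s" using up next_edge[OF i(1)] i(2)[OF ps(2)] by blast
    moreover have "f (xs ! i) = xs ! ?p"
      using up next_edge[OF ps(1)] i(2)[OF ps(1)] ps(3) by (auto simp: insert_commute)
    ultimately show False using ne by simp
  qed
  ultimately show ?thesis using simple by (auto simp: is_tree_def)
qed

end

section \<open>From trees to parent functions\<close>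

lemma tree_imp_parent_function:
  assumes "is_tree V E" "\<rho> \<in> V"
  obtains f where "f \<in> V - {\<rho>} \<rightarrow>\<^sub>E V" "\<And>v. v \<in> V \<Longrightarrow> hits f {\<rho>} v" "E = parent_edges V \<rho> f"
proof -
  have simple: "simple_graph V E" and conn: "connected_graph V E" and acyc: "\<And>xs. \<not> is_cycle E xs"
    using assms(1) by (auto simp: is_tree_def)
  define D where "D v k \<longleftrightarrow> (\<exists>xs. is_walk E xs \<and> hd xs = \<rho> \<and> last xs = v \<and> length xs = k)" for v k
  define d where "d v = (LEAST k. D v k)" for v
  have "\<exists>v. v \<in> V \<and> {w, v} \<in> E \<and> d v < d w" if w: "w \<in> V - {\<rho>}" for w
  proof -
    have "\<exists>k. D w k" using conn w assms(2) by (auto simp: connected_graph_def D_def)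
    then have "D w (d w)" unfolding d_def by (metis LeastI)
    then obtain xs where xs: "is_walk E xs" "hd xs = \<rho>" "last xs = w" "length xs = d w"
      by (auto simp: D_def)
    have ne: "xs \<noteq> []" using xs(1) by (auto simp: is_walk_def)
    define ys where "ys = butlast xs"
    have xs_eq: "xs = ys @ [w]" using ne xs(3) append_butlast_last_id[of xs] by (simp add: ys_def)
    have ys: "ys \<noteq> []" using xs_eq xs(2) w by auto
    then have walk: "is_walk E ys" "{last ys, w} \<in> E" "hd ys = \<rho>"
      using xs xs_eq is_walk_append[of ys "[w]" E] by auto
    then have "D (last ys) (length ys)" by (auto simp: D_def)
    then have "d (last ys) \<le> length ys" unfolding d_def by (rule Least_le)
    moreover have "length ys < d w" using xs(4) xs_eq by auto
    moreover have "last ys \<in> V" using simple walk(2) by (auto simp: simple_graph_def)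
    ultimately show ?thesis using walk(2) by (auto simp: insert_commute intro!: exI[of _ "last ys"])
  qed
  then obtain g where g: "\<And>w. w \<in> V - {\<rho>} \<Longrightarrow> g w \<in> V \<and> {w, g w} \<in> E \<and> d (g w) < d w"
    by metis
  define f where "f = restrict g (V - {\<rho>})"
  have f: "f \<in> V - {\<rho>} \<rightarrow>\<^sub>E V" using g by (auto simp: f_def)
  have hits: "hits f {\<rho>} v" if "v \<in> V" for v
    using that
  proof (induction "d v" arbitrary: v rule: less_induct)
    case less
    show ?case
    proof (cases "v = \<rho>")
      case False
      then have "hits f {\<rho>} (f v)" using less g[of v] by (auto simp: f_def)
      then show ?thesis by (rule hits_step)
    qed (auto intro: hits_base)
  qed
  let ?E = "parent_edges V \<rho> f"
  have sub: "?E \<subseteq> E" using g by (auto simp: parent_edges_def f_def)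
  have f': "f \<in> V - {\<rho>} \<rightarrow> V" using f by auto
  have "connected_graph V ?E"
    using is_tree_parent_edges[OF assms(2) f' hits refl] by (simp add: is_tree_def)
  have "E \<subseteq> ?E"
  proof
    fix e assume e: "e \<in> E"
    then obtain u v where uv: "e = {u, v}" "u \<in> V" "v \<in> V" "u \<noteq> v"
      using simple by (auto simp: simple_graph_def card_2_iff)
    show "e \<in> ?E"
    proof (rule ccontr)
      assume nin: "e \<notin> ?E"
      obtain xs where xs: "is_walk ?E xs" "hd xs = u" "last xs = v"
        using \<open>connected_graph V ?E\<close> uv by (auto simp: connected_graph_def)
      then obtain ys where ys: "is_path ?E ys" "hd ys = u" "last ys = v"
        using is_walk_imp_path by metis
      \<comment> \<open>A path with fewer vertices would give \<open>u = v\<close> or put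
        \<open>e\<close> among the parent edges.\<close>
      have "3 \<le> length ys"
      proof (rule ccontr)
        assume "\<not> 3 \<le> length ys"
        then consider "ys = []" | a where "ys = [a]" | a b where "ys = [a, b]"
          by (cases ys rule: remdups_adj.cases) (auto simp: numeral_3_eq_3 Suc_le_eq)
        then show False
          using ys uv nin by cases (auto simp: is_path_def is_walk_def)
      qed
      then have "is_cycle E ys"
        using ys is_walk_mono[OF _ sub] e uv(1) by (auto simp: is_cycle_def is_path_def insert_commute)
      then show False using acyc by blast
    qed
  qed
  then show ?thesis using that[OF f hits] sub by auto
qed

section \<open>Out-types\<close>

text \<open>Reading off the values along a fixed enumeration of \<open>V\<close> turns
  \<open>g\<close> into a word with prescribed letter multiplicities, that is, a permutation of a
  multiset.\<close>

lemma card_functions_with_fibre_sizes: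
  fixes V :: "'a::linorder set" and k :: "'b \<Rightarrow> nat"
  assumes V: "finite V" and R: "finite R" "\<And>t. t \<notin> R \<Longrightarrow> k t = 0" and sum: "sum k R = card V"
  shows "card {g \<in> V \<rightarrow>\<^sub>E UNIV. \<forall>t. card {v \<in> V. g v = t} = k t} * (\<Prod>t\<in>R. fact (k t)) =
    fact (card V)"
proof -
  define M where "M = (\<Sum>t\<in>R. replicate_mset (k t) t)"
  have count: "count M t = k t" for t
    using R by (auto simp: M_def count_sum)
  have size: "size M = card V" using sum by (simp add: M_def size_multiset_sum)
  define vs where "vs = sorted_list_of_set V"
  have vs: "set vs = V" "distinct vs" "length vs = card V" using V by (auto simp: vs_def)
  have mset_map: "count (mset (map g vs)) t = card {v \<in> V. g v = t}" for g t
  proof -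
    have "count (mset (map g vs)) t = length (filter (\<lambda>v. g v = t) vs)"
      by (induction vs) auto
    also have "\<dots> = card (set (filter (\<lambda>v. g v = t) vs))"
      using vs(2) by (subst distinct_card) simp_all
    finally show ?thesis using vs(1) by simp
  qed
  have "bij_betw (\<lambda>g. map g vs) {g \<in> V \<rightarrow>\<^sub>E UNIV. \<forall>t. card {v \<in> V. g v = t} = k t}
    (permutations_of_multiset M)"
    unfolding bij_betw_def
  proof
    show "inj_on (\<lambda>g. map g vs) {g \<in> V \<rightarrow>\<^sub>E UNIV. \<forall>t. card {v \<in> V. g v = t} = k t}"
    proof (rule inj_onI)
      fix g g' assume "g \<in> {g \<in> V \<rightarrow>\<^sub>E UNIV. \<forall>t. card {v \<in> V. g v = t} = k t}"
        "g' \<in> {g \<in> V \<rightarrow>\<^sub>E UNIV. \<forall>t. card {v \<in> V. g v = t} = k t}" "map g vs = map g' vs"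
      then show "g = g'" using vs(1) by (intro PiE_ext[of g V "\<lambda>_. UNIV" g']) auto
    qed
    have "ys \<in> (\<lambda>g. map g vs) ` {g \<in> V \<rightarrow>\<^sub>E UNIV. \<forall>t. card {v \<in> V. g v = t} = k t}"
      if "mset ys = M" for ys
    proof -
      have len: "length ys = length vs" using that size vs(3) by (metis size_mset)
      define g where "g = (\<lambda>v\<in>V. the (map_of (zip vs ys) v))"
      have g: "map g vs = ys"
      proof (rule nth_equalityI)
        fix i assume i: "i < length (map g vs)"
        then have "vs ! i \<in> V" using vs(1) by auto
        then show "map g vs ! i = ys ! i"
          using i len vs(2) by (simp add: g_def map_of_zip_nth)
      qed (use len in simp)
      have "card {v \<in> V. g v = t} = k t" for t using mset_map[of g t] g that count by simp
      moreover have "g \<in> V \<rightarrow>\<^sub>E UNIV" by (simp add: g_def)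
      ultimately show ?thesis using g by blast
    qed
    moreover have "mset (map g vs) = M" if "\<forall>t. card {v \<in> V. g v = t} = k t" for g
      using that mset_map[of g] count by (intro multiset_eqI) simp
    ultimately show "(\<lambda>g. map g vs) ` {g \<in> V \<rightarrow>\<^sub>E UNIV. \<forall>t. card {v \<in> V. g v = t} = k t} =
      permutations_of_multiset M"
      by (auto simp: permutations_of_multiset_def)
  qed
  then have "card {g \<in> V \<rightarrow>\<^sub>E UNIV. \<forall>t. card {v \<in> V. g v = t} = k t} =
    card (permutations_of_multiset M)" by (rule bij_betw_same_card)
  moreover have "(\<Prod>t\<in>R. fact (k t)) = (\<Prod>t\<in>set_mset M. fact (count M t) :: nat)"
  proof (rule prod.mono_neutral_cong_right)
    show "set_mset M \<subseteq> R" using R(2) count by (metis count_eq_zero_iff subsetI)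
    show "\<forall>t\<in>R - set_mset M. fact (k t) = 1" using count by (auto simp: count_eq_zero_iff[symmetric])
  qed (use R count in auto)
  ultimately show ?thesis
    using card_permutations_of_multiset[of M] by (simp only: size dvd_div_mult_self)
qed

section \<open>Embedded trees as parent functions with abscissas\<close>

definition parent_data ::
    "int set \<Rightarrow> (int \<Rightarrow> int \<Rightarrow> nat) \<Rightarrow> nat \<Rightarrow> (nat \<times> (nat \<Rightarrow> int) \<times> (nat \<Rightarrow> nat)) set" where
  "parent_data S m N = {(\<rho>, a, f). \<rho> \<in> {1..N} \<and> a \<in> {1..N} \<rightarrow>\<^sub>E UNIV \<and> a \<rho> = 0 \<and>
     f \<in> {1..N} - {\<rho>} \<rightarrow>\<^sub>E {1..N} \<and> (\<forall>v\<in>{1..N}. hits f {\<rho>} v) \<and>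
     (\<forall>v\<in>{1..N} - {\<rho>}. a v - a (f v) \<in> S) \<and>
     (\<forall>i. \<forall>s\<in>S. card {v \<in> {1..N} - {\<rho>}. a v = i \<and> a (f v) = i - s} = m i s)}"

lemma embedded_tree_iff_parent_data:
  assumes "\<rho> \<in> {1..N}" "f \<in> {1..N} - {\<rho>} \<rightarrow>\<^sub>E {1..N}" "\<And>v. v \<in> {1..N} \<Longrightarrow> hits f {\<rho>} v"
  shows "(N, parent_edges {1..N} \<rho> f, \<rho>, a) \<in> embedded_cayley_trees_with_out_types S m \<longleftrightarrow>
    (\<rho>, a, f) \<in> parent_data S m N"
proof -
  let ?E = "parent_edges {1..N} \<rho> f"
  note [simp del] = One_nat_def
  have f: "f \<in> {1..N} - {\<rho>} \<rightarrow> {1..N}" using assms(2) by auto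
  have child: "is_child ?E \<rho> w v \<longleftrightarrow> w \<in> {1..N} - {\<rho>} \<and> f w = v" for v w
    using is_child_parent_edges_iff[OF assms(1) f assms(3) refl] .
  have "rooted_cayley_tree N ?E \<rho>"
    using is_tree_parent_edges[OF assms(1) f assms(3) refl] assms(1)
    by (simp add: rooted_cayley_tree_def)
  moreover have "{v \<in> {1..N}. has_out_type ?E \<rho> a v i s} =
    {v \<in> {1..N} - {\<rho>}. a v = i \<and> a (f v) = i - s}" for i s
    by (auto simp: has_out_type_def child)
  moreover have "(\<forall>v\<in>{1..N}. \<forall>w\<in>{1..N}. is_child ?E \<rho> w v \<longrightarrow> a w - a v \<in> S) \<longleftrightarrow>
    (\<forall>v\<in>{1..N} - {\<rho>}. a v - a (f v) \<in> S)"
    using f unfolding child by blast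
  ultimately show ?thesis
    using assms
    by (simp add: embedded_cayley_trees_with_out_types_def embedded_cayley_tree_def parent_data_def)
qed

text \<open>The set of embedded trees leaves the size open. It is forced, because each non-root
  vertex has exactly one out-type, and the root accounts for the successor.\<close>

lemma parent_data_size:
  assumes "finite {(i, s). s \<in> S \<and> m i s \<noteq> 0}" "(\<rho>, a, f) \<in> parent_data S m N"
  shows "N = Suc (\<Sum>(i, s) | s \<in> S \<and> m i s \<noteq> 0. m i s)"
proof -
  note [simp del] = One_nat_def
  let ?W = "{1..N} - {\<rho>}" and ?T = "{(i, s). s \<in> S \<and> m i s \<noteq> 0}"
  let ?g = "\<lambda>v. (a v, a v - a (f v))"
  have data: "\<rho> \<in> {1..N}" "\<And>v. v \<in> ?W \<Longrightarrow> a v - a (f v) \<in> S"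
    "\<And>i s. s \<in> S \<Longrightarrow> card {v \<in> ?W. a v = i \<and> a (f v) = i - s} = m i s"
    using assms(2) by (auto simp: parent_data_def)
  have fibre: "{v \<in> ?W. ?g v = (i, s)} = {v \<in> ?W. a v = i \<and> a (f v) = i - s}" for i s by auto
  have "?g ` ?W \<subseteq> ?T"
  proof
    fix p assume "p \<in> ?g ` ?W"
    then obtain v where v: "v \<in> ?W" "p = ?g v" by blast
    obtain i s where p: "p = (i, s)" by force
    have "{v \<in> ?W. ?g v = (i, s)} \<noteq> {}" using v p by auto
    then have "card {v \<in> ?W. ?g v = (i, s)} \<noteq> 0"
      by (subst card_0_eq) auto
    moreover have "s \<in> S" using data(2)[OF v(1)] v(2) p by auto
    ultimately show "p \<in> ?T" unfolding fibre data(3)[OF \<open>s \<in> S\<close>] p by simp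
  qed
  then have "(\<Sum>p\<in>?T. \<Sum>v\<in>{v \<in> ?W. ?g v = p}. 1) = (\<Sum>v\<in>?W. 1::nat)"
    using assms(1) by (intro sum.group) auto
  moreover have "(\<Sum>v\<in>{v \<in> ?W. ?g v = p}. 1) = (case p of (i, s) \<Rightarrow> m i s)" if "p \<in> ?T" for p
  proof -
    obtain i s where p: "p = (i, s)" by force
    have "s \<in> S" using that p by simp
    then show ?thesis unfolding p fibre using data(3)[of s i] by simp
  qed
  ultimately have "(\<Sum>(i, s) | s \<in> S \<and> m i s \<noteq> 0. m i s) = card ?W" by simp
  then show ?thesis using data(1) by simp
qed

text \<open>The child relation of the edge set returns the parent function, so distinct functions
  with the same root give distinct trees.\<close>

lemma card_embedded_trees_eq_parent_data:
  assumes "finite {(i, s). s \<in> S \<and> m i s \<noteq> 0}"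
    and "n = Suc (\<Sum>(i, s) | s \<in> S \<and> m i s \<noteq> 0. m i s)"
  shows "card (embedded_cayley_trees_with_out_types S m) = card (parent_data S m n)"
proof -
  let ?G = "\<lambda>(\<rho>, a, f). (n, parent_edges {1..n} \<rho> f, \<rho>, a)"
  have "inj_on ?G (parent_data S m n)"
  proof (rule inj_onI, clarsimp)
    fix \<rho> a f g
    assume fg: "(\<rho>, a, f) \<in> parent_data S m n" "(\<rho>, a, g) \<in> parent_data S m n"
      and eq: "parent_edges {Suc 0..n} \<rho> f = parent_edges {Suc 0..n} \<rho> g"
    have "f v = g v" if "v \<in> {1..n} - {\<rho>}" for v
    proof -
      have "is_child (parent_edges {1..n} \<rho> h) \<rho> v u \<longleftrightarrow> h v = u"
        if "(\<rho>, a, h) \<in> parent_data S m n" for h u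
        using is_child_parent_edges_iff[of \<rho> "{1..n}" h "parent_edges {1..n} \<rho> h" v u]
          \<open>v \<in> {1..n} - {\<rho>}\<close> that
        by (auto simp: parent_data_def)
      from this[OF fg(1)] this[OF fg(2)] show ?thesis using eq by simp
    qed
    then show "f = g" using fg
      by (intro PiE_ext[of f "{1..n} - {\<rho>}" "\<lambda>_. {1..n}" g]) (auto simp: parent_data_def)
  qed
  moreover have "?G ` parent_data S m n = embedded_cayley_trees_with_out_types S m"
  proof (intro equalityI subsetI)
    fix x assume "x \<in> ?G ` parent_data S m n"
    then obtain \<rho> a f where "(\<rho>, a, f) \<in> parent_data S m n" "x = ?G (\<rho>, a, f)" by auto
    then show "x \<in> embedded_cayley_trees_with_out_types S m"
      using embedded_tree_iff_parent_data[of \<rho> n f a S m] by (auto simp: parent_data_def)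
  next
    fix x assume x: "x \<in> embedded_cayley_trees_with_out_types S m"
    obtain N E \<rho> a where x_eq: "x = (N, E, \<rho>, a)" by (metis prod_cases4)
    have tree: "is_tree {1..N} E" "\<rho> \<in> {1..N}"
      using x x_eq by (auto simp: embedded_cayley_trees_with_out_types_def
        embedded_cayley_tree_def rooted_cayley_tree_def)
    obtain f where f: "f \<in> {1..N} - {\<rho>} \<rightarrow>\<^sub>E {1..N}" "\<And>v. v \<in> {1..N} \<Longrightarrow> hits f {\<rho>} v"
      "E = parent_edges {1..N} \<rho> f"
      using tree_imp_parent_function[OF tree] by metis
    then have data: "(\<rho>, a, f) \<in> parent_data S m N"
      using embedded_tree_iff_parent_data[OF tree(2) f(1,2)] x x_eq by simp
    have "N = n" using parent_data_size[OF assms(1) data] assms(2) by simp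
    then have "x = ?G (\<rho>, a, f)" "(\<rho>, a, f) \<in> parent_data S m n" using data x_eq f(3) by simp_all
    then show "x \<in> ?G ` parent_data S m n" by (rule image_eqI)
  qed
  ultimately show ?thesis using card_image[of ?G "parent_data S m n"] by simp
qed

section \<open>Assignments of out-types to vertices\<close>

text \<open>The root carries the extra type \<open>None\<close> of multiplicity 1. The choice of the
  root is thereby part of the assignment, and the assignments are counted by a single multinomial
  coefficient with numerator \<open>fact n\<close>.\<close>

definition type_count :: "int set \<Rightarrow> (int \<Rightarrow> int \<Rightarrow> nat) \<Rightarrow> (int \<times> int) option \<Rightarrow> nat" where
  "type_count S m t = (case t of None \<Rightarrow> 1 | Some (i, s) \<Rightarrow> if s \<in> S then m i s else 0)"

definition type_functions ::
    "int set \<Rightarrow> (int \<Rightarrow> int \<Rightarrow> nat) \<Rightarrow> nat \<Rightarrow> (nat \<Rightarrow> (int \<times> int) option) set" where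
  "type_functions S m n =
     {\<tau> \<in> {1..n} \<rightarrow>\<^sub>E UNIV. \<forall>t. card {v \<in> {1..n}. \<tau> v = t} = type_count S m t}"

definition out_type_function ::
    "nat \<Rightarrow> nat \<times> (nat \<Rightarrow> int) \<times> (nat \<Rightarrow> nat) \<Rightarrow> nat \<Rightarrow> (int \<times> int) option" where
  "out_type_function n = (\<lambda>(\<rho>, a, f). \<lambda>v\<in>{1..n}. if v = \<rho> then None else Some (a v, a v - a (f v)))"

definition type_level :: "(int \<times> int) option \<Rightarrow> int" where
  "type_level t = (case t of None \<Rightarrow> 0 | Some (i, s) \<Rightarrow> i)"

definition type_target :: "(int \<times> int) option \<Rightarrow> int" where
  "type_target t = (case t of None \<Rightarrow> 0 | Some (i, s) \<Rightarrow> i - s)"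

lemma card_type_functions:
  assumes "finite {(i, s). s \<in> S \<and> m i s \<noteq> 0}"
    and "n = Suc (\<Sum>(i, s) | s \<in> S \<and> m i s \<noteq> 0. m i s)"
  shows "card (type_functions S m n) * (\<Prod>(i, s) | s \<in> S \<and> m i s \<noteq> 0. fact (m i s)) = fact n"
proof -
  let ?T = "{(i, s). s \<in> S \<and> m i s \<noteq> 0}"
  have "sum (type_count S m) (insert None (Some ` ?T)) = n"
    using assms by (subst sum.insert) (auto simp: sum.reindex type_count_def intro!: sum.cong)
  moreover have "(\<Prod>t\<in>insert None (Some ` ?T). fact (type_count S m t)) =
    (\<Prod>(i, s)\<in>?T. fact (m i s) :: nat)"
    using assms(1) by (subst prod.insert) (auto simp: prod.reindex type_count_def intro!: prod.cong)
  moreover have "card (type_functions S m n) *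
    (\<Prod>t\<in>insert None (Some ` ?T). fact (type_count S m t)) = fact (card {1..n})"
    unfolding type_functions_def
    by (rule card_functions_with_fibre_sizes)
      (use assms(1) calculation(1) in \<open>auto simp: type_count_def split: option.splits\<close>)
  ultimately show ?thesis by simp
qed

lemma card_types_in:
  assumes "\<tau> \<in> type_functions S m n" "finite B"
  shows "card {v \<in> {1..n}. \<tau> v \<in> B} = sum (type_count S m) B"
proof -
  have "(\<Sum>t\<in>B. \<Sum>v\<in>{v \<in> {v \<in> {1..n}. \<tau> v \<in> B}. \<tau> v = t}. 1) = (\<Sum>v\<in>{v \<in> {1..n}. \<tau> v \<in> B}. 1::nat)"
    using assms(2) by (intro sum.group) auto
  moreover have "{v \<in> {v \<in> {1..n}. \<tau> v \<in> B}. \<tau> v = t} = {v \<in> {1..n}. \<tau> v = t}" if "t \<in> B" for t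
    using that by auto
  ultimately show ?thesis using assms(1) by (simp add: type_functions_def)
qed

lemma type_count_pos:
  assumes "\<tau> \<in> type_functions S m n" "v \<in> {1..n}"
  shows "type_count S m (\<tau> v) > 0"
proof -
  have "card {w \<in> {1..n}. \<tau> w = \<tau> v} > 0" using assms(2) by (subst card_gt_0_iff) auto
  then show ?thesis using assms(1) by (simp add: type_functions_def)
qed

lemma type_functions_root:
  assumes "\<tau> \<in> type_functions S m n"
  obtains \<rho> where "\<rho> \<in> {1..n}" "\<And>v. v \<in> {1..n} \<Longrightarrow> \<tau> v = None \<longleftrightarrow> v = \<rho>"
proof -
  have "card {v \<in> {1..n}. \<tau> v = None} = 1"
    using assms by (simp add: type_functions_def type_count_def)
  then obtain \<rho> where \<rho>: "{v \<in> {1..n}. \<tau> v = None} = {\<rho>}" by (rule card_1_singletonE)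
  show ?thesis
  proof (rule that)
    show "\<rho> \<in> {1..n}" using \<rho> by blast
    show "\<tau> v = None \<longleftrightarrow> v = \<rho>" if "v \<in> {1..n}" for v
      using eqset_imp_iff[OF \<rho>, of v] that by simp
  qed
qed

lemma out_type_function_in:
  assumes "x \<in> parent_data S m n"
  shows "out_type_function n x \<in> type_functions S m n"
proof -
  note [simp del] = One_nat_def
  obtain \<rho> a f where x: "x = (\<rho>, a, f)" by (metis prod_cases3)
  let ?\<tau> = "out_type_function n (\<rho>, a, f)"
  have data: "\<rho> \<in> {1..n}" "\<And>v. v \<in> {1..n} - {\<rho>} \<Longrightarrow> a v - a (f v) \<in> S"
    "\<And>i s. s \<in> S \<Longrightarrow> card {v \<in> {1..n} - {\<rho>}. a v = i \<and> a (f v) = i - s} = m i s"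
    using assms x by (auto simp: parent_data_def)
  have "card {v \<in> {1..n}. ?\<tau> v = t} = type_count S m t" for t
  proof (cases t)
    case None
    then have "{v \<in> {1..n}. ?\<tau> v = t} = {\<rho>}" using data(1) by (auto simp: out_type_function_def)
    then show ?thesis using None by (simp add: type_count_def)
  next
    case (Some p)
    then obtain i s where t: "t = Some (i, s)" by (cases p) auto
    have eq: "{v \<in> {1..n}. ?\<tau> v = t} = {v \<in> {1..n} - {\<rho>}. a v = i \<and> a (f v) = i - s}"
      unfolding t by (auto simp: out_type_function_def)
    show ?thesis
    proof (cases "s \<in> S")
      case False
      then have "{v \<in> {1..n}. ?\<tau> v = t} = {}" using data(2) unfolding eq by force
      then show ?thesis using False t by (simp add: type_count_def)
    qed (use data(3) eq t in \<open>simp add: type_count_def\<close>)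
  qed
  then show ?thesis by (auto simp: x type_functions_def out_type_function_def)
qed

text \<open>The types already determine the root and all abscissas. What remains free is the parent
  function, restricted only to the prescribed abscissas and to leading to the root.\<close>

lemma parent_data_fibre:
  assumes \<tau>: "\<tau> \<in> type_functions S m n"
    and root: "\<rho> \<in> {1..n}" "\<And>v. v \<in> {1..n} \<Longrightarrow> \<tau> v = None \<longleftrightarrow> v = \<rho>"
  shows "card {x \<in> parent_data S m n. out_type_function n x = \<tau>} =
    card {f \<in> Pi\<^sub>E ({1..n} - {\<rho>}) (\<lambda>v. {u \<in> {1..n}. type_level (\<tau> u) = type_target (\<tau> v)}).
      \<forall>v\<in>{1..n}. hits f {\<rho>} v}" (is "card ?D = card ?F")
    and "finite {x \<in> parent_data S m n. out_type_function n x = \<tau>}"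
proof -
  note [simp del] = One_nat_def
  define a where "a = (\<lambda>v\<in>{1..n}. type_level (\<tau> v))"
  have ext: "\<tau> \<in> extensional {1..n}" using \<tau> by (auto simp: type_functions_def PiE_iff)
  have image: "(\<lambda>f. (\<rho>, a, f)) ` ?F = ?D"
  proof (intro equalityI subsetI)
    fix x assume "x \<in> (\<lambda>f. (\<rho>, a, f)) ` ?F"
    then obtain f where x: "x = (\<rho>, a, f)" and f: "f \<in> ?F" by auto
    have fv: "f v \<in> {1..n}" "a (f v) = type_target (\<tau> v)" if "v \<in> {1..n} - {\<rho>}" for v
      using f that by (auto simp: a_def PiE_iff)
    have \<tau>v: "\<tau> v = Some (a v, a v - a (f v))" if v: "v \<in> {1..n} - {\<rho>}" for v
    proof -
      obtain i s where "\<tau> v = Some (i, s)" using root(2)[of v] v by (cases "\<tau> v") auto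
      then show ?thesis using fv(2)[OF v] v by (simp add: a_def type_level_def type_target_def)
    qed
    have "out_type_function n x = \<tau>"
    proof (rule extensionalityI[OF _ ext])
      show "out_type_function n x v = \<tau> v" if "v \<in> {1..n}" for v
        using that \<tau>v[of v] root(2)[of v] by (auto simp: x out_type_function_def)
    qed (auto simp: x out_type_function_def)
    moreover have "x \<in> parent_data S m n"
      unfolding x parent_data_def mem_Collect_eq prod.case
    proof (intro conjI ballI allI)
      show "a \<in> {1..n} \<rightarrow>\<^sub>E UNIV" by (simp add: a_def)
      show "a \<rho> = 0" using root(1) root(2)[OF root(1)] by (simp add: a_def type_level_def)
      show "f \<in> {1..n} - {\<rho>} \<rightarrow>\<^sub>E {1..n}" using f by (auto simp: PiE_iff)
      show "hits f {\<rho>} v" if "v \<in> {1..n}" for v using f that by auto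
      show "a v - a (f v) \<in> S" if v: "v \<in> {1..n} - {\<rho>}" for v
        using type_count_pos[OF \<tau>, of v] \<tau>v[OF v] v by (auto simp: type_count_def split: if_splits)
      fix i s assume s: "s \<in> S"
      have "{v \<in> {1..n} - {\<rho>}. a v = i \<and> a (f v) = i - s} = {v \<in> {1..n}. \<tau> v = Some (i, s)}"
        using \<tau>v root by force
      then show "card {v \<in> {1..n} - {\<rho>}. a v = i \<and> a (f v) = i - s} = m i s"
        using \<tau> s by (simp add: type_functions_def type_count_def)
    qed (rule root(1))
    ultimately show "x \<in> ?D" by simp
  next
    fix x assume x: "x \<in> ?D"
    obtain \<rho>' b f where x_eq: "x = (\<rho>', b, f)" by (metis prod_cases3)
    have data: "\<rho>' \<in> {1..n}" "b \<in> {1..n} \<rightarrow>\<^sub>E UNIV" "b \<rho>' = 0" "f \<in> {1..n} - {\<rho>'} \<rightarrow>\<^sub>E {1..n}"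
      "\<forall>v\<in>{1..n}. hits f {\<rho>'} v"
      using x x_eq by (auto simp: parent_data_def)
    have \<tau>_eq: "\<tau> v = (if v = \<rho>' then None else Some (b v, b v - b (f v)))" if "v \<in> {1..n}" for v
      using x that by (auto simp: x_eq out_type_function_def)
    have \<rho>: "\<rho>' = \<rho>" using \<tau>_eq[OF data(1)] root(2)[OF data(1)] by simp
    have "b = a"
    proof (rule PiE_ext[OF data(2)])
      show "b v = a v" if "v \<in> {1..n}" for v
        using that \<tau>_eq[OF that] data(3) by (auto simp: a_def type_level_def)
    qed (simp add: a_def)
    have "f \<in> Pi\<^sub>E ({1..n} - {\<rho>}) (\<lambda>v. {u \<in> {1..n}. type_level (\<tau> u) = type_target (\<tau> v)})"
      unfolding PiE_iff
    proof (intro conjI ballI)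
      fix v assume v: "v \<in> {1..n} - {\<rho>}"
      then have fv: "f v \<in> {1..n}" using data(4) unfolding \<rho> by (rule PiE_mem[rotated])
      then have level: "type_level (\<tau> (f v)) = b (f v)" unfolding \<open>b = a\<close> by (simp add: a_def)
      have "\<tau> v = Some (b v, b v - b (f v))" using \<tau>_eq[of v] v \<rho> by simp
      then have "type_target (\<tau> v) = b (f v)" by (simp add: type_target_def)
      then show "f v \<in> {u \<in> {1..n}. type_level (\<tau> u) = type_target (\<tau> v)}"
        using fv level by simp
    next
      show "f \<in> extensional ({1..n} - {\<rho>})" using data(4) unfolding \<rho> PiE_iff by (rule conjunct2)
    qed
    then have "f \<in> ?F" using data(5) unfolding \<rho> by blast
    then show "x \<in> (\<lambda>f. (\<rho>, a, f)) ` ?F" unfolding x_eq \<rho> \<open>b = a\<close> by (rule imageI)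
  qed
  have "inj_on (\<lambda>f. (\<rho>, a, f)) ?F" by (auto intro: inj_onI)
  then show "card ?D = card ?F" unfolding image[symmetric] by (rule card_image)
  have "finite ?F" by (intro finite_Collect_conjI disjI1) (auto intro: finite_PiE)
  then show "finite ?D" unfolding image[symmetric] by (rule finite_imageI)
qed

section \<open>Assembly of the formula\<close>

theorem theorem2p3:
  fixes S :: "int set"
    and m :: "int \<Rightarrow> int \<Rightarrow> nat"
    and nn c :: "int \<Rightarrow> nat"
    and l r :: int
    and n :: nat
  assumes max_S: "1 \<in> S" "\<forall>s\<in>S. s \<le> 1"
    and min_S_or_nonneg:
      "(-1 \<in> S \<and> (\<forall>s\<in>S. -1 \<le> s)) \<or> (\<forall>i<0. \<forall>s\<in>S. m i s = 0)"
    and finite_support: "finite {(i, s). s \<in> S \<and> m i s \<noteq> 0}"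
    and nn_eq: "nn = abscissa_count S m"
    and c_eq: "c = child_count S m"
    and l_eq: "l = Min {i. nn i > 0}"
    and r_eq: "r = Max {i. nn i > 0}"
    and no_gap: "\<forall>i\<in>{l..r}. nn i > 0"
    and parents_exist: "\<forall>i. nn i = 0 \<longrightarrow> c i = 0"
    and n_eq: "n = (\<Sum>i | nn i > 0. nn i)"
  shows "real (card (embedded_cayley_trees_with_out_types S m)) =
    fact n * (\<Prod>i = l..r. real (nn i) powi (int (c i) - 1))
           * (\<Prod>i = l..-1. real (m i (-1))) * (\<Prod>i = 1..r. real (m i 1))
      / (\<Prod>(i, s) | s \<in> S \<and> m i s \<noteq> 0. fact (m i s))"
proof -
  note [simp del] = One_nat_def
  let ?T = "{(i, s). s \<in> S \<and> m i s \<noteq> 0}" and ?V = "{1..n}"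
  let ?st = "\<lambda>i. {s. s \<in> S \<and> m i s \<noteq> 0}" and ?st' = "\<lambda>i. {s. s \<in> S \<and> m (i + s) s \<noteq> 0}"
  define I where "I = {i. nn i > 0}"
  have st: "finite (?st i)" for i
    by (rule finite_subset[OF _ finite_imageI[OF finite_support, of snd]]) force
  have st': "finite (?st' i)" for i
    by (rule finite_subset[OF _ finite_imageI[OF finite_support, of snd]]) force
  have nn: "nn i = (\<Sum>s\<in>?st i. m i s) + of_bool (i = 0)" for i
    by (simp add: nn_eq abscissa_count_def)
  have nn_pos: "nn i > 0 \<longleftrightarrow> i = 0 \<or> (\<exists>s\<in>S. m i s \<noteq> 0)" for i
  proof -
    have "nn i = 0 \<longleftrightarrow> (\<forall>s\<in>?st i. m i s = 0) \<and> i \<noteq> 0"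
      unfolding nn add_is_0 sum_eq_0_iff[OF st] by simp
    then show ?thesis unfolding neq0_conv[symmetric] by auto
  qed
  have I_sub: "I \<subseteq> insert 0 (fst ` ?T)" unfolding I_def nn_pos by force
  have I: "finite I" "0 \<in> I"
    using finite_subset[OF I_sub] finite_support by (auto simp: I_def nn_pos)
  have lr: "nn i > 0 \<longleftrightarrow> l \<le> i \<and> i \<le> r" for i
  proof
    assume "nn i > 0"
    then have "i \<in> I" by (simp add: I_def)
    then show "l \<le> i \<and> i \<le> r"
      unfolding l_eq r_eq I_def[symmetric] using I(1) by simp
  qed (use no_gap in simp)
  have l0: "l \<le> 0" "0 \<le> r" using lr[of 0] nn_pos[of 0] by auto
  have n: "n = Suc (\<Sum>(i, s)\<in>?T. m i s)"
  proof -
    have "n = (\<Sum>i\<in>I. \<Sum>s\<in>?st i. m i s) + (\<Sum>i\<in>I. of_bool (i = 0))"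
      unfolding n_eq I_def[symmetric] sum.distrib[symmetric] by (intro sum.cong refl nn)
    also have "(\<Sum>i\<in>I. of_bool (i = 0)) = (1::nat)"
      using I by (simp add: of_bool_def sum.delta)
    also have "(\<Sum>i\<in>I. \<Sum>s\<in>?st i. m i s) = (\<Sum>(i, s)\<in>(SIGMA i:I. ?st i). m i s)"
      using I st by (intro sum.Sigma) auto
    also have "(SIGMA i:I. ?st i) = ?T" unfolding I_def nn_pos by auto
    finally show ?thesis by simp
  qed
  \<comment> \<open>The right-hand side does not involve \<open>\<tau>\<close>, so all type
    assignments have equally many trees above them.\<close>
  have fibre: "(\<Prod>i = l..r. nn i) * card {x \<in> parent_data S m n. out_type_function n x = \<tau>} =
    (\<Prod>i = l..-1. m i (-1)) * (\<Prod>i = 1..r. m i 1) * (\<Prod>i = l..r. nn i ^ c i)"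
    if \<tau>: "\<tau> \<in> type_functions S m n" for \<tau>
  proof -
    obtain \<rho> where \<rho>: "\<rho> \<in> ?V" "\<And>v. v \<in> ?V \<Longrightarrow> \<tau> v = None \<longleftrightarrow> v = \<rho>"
      using type_functions_root[OF \<tau>] by blast
    let ?lev = "\<lambda>v. type_level (\<tau> v)" and ?tgt = "\<lambda>v. type_target (\<tau> v)"
    have types: "v = \<rho> \<and> \<tau> v = None \<or>
      (v \<noteq> \<rho> \<and> (\<exists>i s. \<tau> v = Some (i, s) \<and> s \<in> S \<and> m i s \<noteq> 0))" if "v \<in> ?V" for v
      using type_count_pos[OF \<tau> that] \<rho>(2)[OF that]
      by (auto simp: type_count_def split: option.splits if_splits)
    have lev_root: "?lev \<rho> = 0" using types[OF \<rho>(1)] by (auto simp: type_level_def)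
    have card_level: "card {v \<in> ?V. ?lev v = i} = nn i" for i
    proof -
      let ?B = "Some ` ({i} \<times> ?st i) \<union> (if i = 0 then {None} else {})"
      have "?lev v = i \<longleftrightarrow> \<tau> v \<in> ?B" if "v \<in> ?V" for v
        using types[OF that] by (auto simp: type_level_def)
      then have "{v \<in> ?V. ?lev v = i} = {v \<in> ?V. \<tau> v \<in> ?B}"
        by (intro Collect_cong conj_cong refl)
      moreover have "finite ?B" using st[of i] by auto
      moreover have "sum (type_count S m) ?B = nn i"
      proof -
        have "sum (type_count S m) (Some ` ({i} \<times> ?st i)) = (\<Sum>s\<in>?st i. m i s)"
          by (rule sum.reindex_bij_witness[of _ "\<lambda>s. Some (i, s)" "\<lambda>t. snd (the t)"])
            (auto simp: type_count_def)
        then show ?thesis unfolding nn using st[of i]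
          by (subst sum.union_disjoint) (auto simp: type_count_def)
      qed
      ultimately show ?thesis using card_types_in[OF \<tau>, of ?B] by (simp only:)
    qed
    have card_step: "card {v \<in> ?V. ?lev v = i \<and> ?tgt v = i - s} = m i s" if "i \<noteq> 0" "s \<in> S" for i s
    proof -
      have "{v \<in> ?V. ?lev v = i \<and> ?tgt v = i - s} = {v \<in> ?V. \<tau> v = Some (i, s)}"
        using that by (auto simp: type_level_def type_target_def split: option.splits)
      then show ?thesis using \<tau> that by (simp add: type_functions_def type_count_def)
    qed
    have card_target: "card {v \<in> ?V - {\<rho>}. ?tgt v = i} = c i" for i
    proof -
      let ?B = "(\<lambda>s. Some (i + s, s)) ` ?st' i"
      have "{v \<in> ?V - {\<rho>}. ?tgt v = i} = {v \<in> ?V. \<tau> v \<in> ?B}"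
      proof (intro equalityI subsetI)
        fix v assume v: "v \<in> {v \<in> ?V - {\<rho>}. ?tgt v = i}"
        then obtain j s where "\<tau> v = Some (j, s)" "s \<in> S" "m j s \<noteq> 0" using types by blast
        moreover from this have "j = i + s" using v by (simp add: type_target_def)
        ultimately show "v \<in> {v \<in> ?V. \<tau> v \<in> ?B}" using v by auto
      next
        fix v assume v: "v \<in> {v \<in> ?V. \<tau> v \<in> ?B}"
        then show "v \<in> {v \<in> ?V - {\<rho>}. ?tgt v = i}"
          using types[of v] by (auto simp: type_target_def)
      qed
      moreover have "finite ?B" using st' by auto
      moreover have "sum (type_count S m) ?B = c i"
        unfolding c_eq child_count_def
        by (subst sum.reindex) (auto simp: type_count_def inj_on_def)
      ultimately show ?thesis using card_types_in[OF \<tau>, of ?B] by (simp only:)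
    qed
    \<comment> \<open>By \<open>parents_exist\<close> no vertex has its parent at an empty abscissa;
      hence the product over vertices can be grouped by targets in \<open>{l..r}\<close>.\<close>
    have tgt_in: "?tgt v \<in> {l..r}" if "v \<in> ?V - {\<rho>}" for v
    proof -
      have "card {w \<in> ?V - {\<rho>}. ?tgt w = ?tgt v} \<noteq> 0" using that by (subst card_0_eq) auto
      then show ?thesis
        using card_target[of "?tgt v"] parents_exist lr[of "?tgt v"] by (metis atLeastAtMost_iff not_gr_zero)
    qed
    have "(\<Prod>i = l..r. card {v \<in> ?V. ?lev v = i}) *
        card {f \<in> Pi\<^sub>E (?V - {\<rho>}) (\<lambda>v. {u \<in> ?V. ?lev u = ?tgt v}). \<forall>v\<in>?V. hits f {\<rho>} v} =
      (\<Prod>i = l..-1. card {v \<in> ?V. ?lev v = i \<and> ?tgt v = i + 1}) *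
      (\<Prod>i = 1..r. card {v \<in> ?V. ?lev v = i \<and> ?tgt v = i - 1}) *
      (\<Prod>v\<in>?V - {\<rho>}. card {u \<in> ?V. ?lev u = ?tgt v})"
    proof (rule card_parent_functions)
      show "?lev v - 1 \<le> ?tgt v" if "v \<in> ?V" "0 < ?lev v" for v
        using types[OF that(1)] that(2) max_S(2) by (auto simp: type_level_def type_target_def)
      \<comment> \<open>A vertex at a negative abscissa excludes the second alternative of
        \<open>min_S_or_nonneg\<close>, which leaves \<open>s \<ge> -1\<close>.\<close>
      show "?tgt v \<le> ?lev v + 1" if "v \<in> ?V" "?lev v < 0" for v
        using types[OF that(1)] that(2) min_S_or_nonneg
        by (auto simp: type_level_def type_target_def)
      show "{v \<in> ?V. ?lev v = i} \<noteq> {}" if "l \<le> i" "i \<le> r" for i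
      proof
        assume "{v \<in> ?V. ?lev v = i} = {}"
        then have "nn i = 0" using card_level[of i] by (simp only: card.empty)
        then show False using lr[of i] that by simp
      qed
      show "l \<le> ?lev v \<and> ?lev v \<le> r" if "v \<in> ?V" for v
      proof -
        have "card {w \<in> ?V. ?lev w = ?lev v} \<noteq> 0" using that by (subst card_0_eq) auto
        then show ?thesis unfolding card_level using lr[of "?lev v"] by simp
      qed
    qed (use \<rho> lev_root in auto)
    moreover have "(\<Prod>i = l..-1. card {v \<in> ?V. ?lev v = i \<and> ?tgt v = i + 1}) =
      (\<Prod>i = l..-1. m i (-1))"
    proof (rule prod.cong[OF refl])
      fix i assume i: "i \<in> {l..-1}"
      then have "\<exists>s\<in>S. m i s \<noteq> 0" using lr[of i] l0 nn_pos[of i] by auto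
      \<comment> \<open>Under the other alternative \<open>l = 0\<close> and the product is empty,
        so \<open>-1\<close> need not lie in \<open>S\<close> there.\<close>
      then have "-1 \<in> S" using min_S_or_nonneg i by auto
      then show "card {v \<in> ?V. ?lev v = i \<and> ?tgt v = i + 1} = m i (-1)"
        using card_step[of i "-1"] i by simp
    qed
    moreover have "(\<Prod>i = 1..r. card {v \<in> ?V. ?lev v = i \<and> ?tgt v = i - 1}) = (\<Prod>i = 1..r. m i 1)"
      using card_step max_S(1) by (intro prod.cong) auto
    moreover have "(\<Prod>v\<in>?V - {\<rho>}. card {u \<in> ?V. ?lev u = ?tgt v}) = (\<Prod>i = l..r. nn i ^ c i)"
    proof -
      have "(\<Prod>i\<in>{l..r}. \<Prod>v\<in>{v \<in> ?V - {\<rho>}. ?tgt v = i}. nn (?tgt v)) = (\<Prod>v\<in>?V - {\<rho>}. nn (?tgt v))"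
        by (intro prod.group image_subsetI tgt_in) simp_all
      moreover have "(\<Prod>v\<in>{v \<in> ?V - {\<rho>}. ?tgt v = i}. nn (?tgt v)) = nn i ^ c i" for i
      proof -
        have "(\<Prod>v\<in>{v \<in> ?V - {\<rho>}. ?tgt v = i}. nn (?tgt v)) = (\<Prod>v\<in>{v \<in> ?V - {\<rho>}. ?tgt v = i}. nn i)"
          by (rule prod.cong) auto
        then show ?thesis using card_target[of i] by simp
      qed
      ultimately show ?thesis unfolding card_level by simp
    qed
    moreover note parent_data_fibre(1)[OF \<tau> \<rho>(1)] \<rho>(2)
    ultimately show ?thesis unfolding card_level by (simp only:)
  qed
  define \<kappa> :: real where "\<kappa> = (\<Prod>i = l..-1. real (m i (-1))) * (\<Prod>i = 1..r. real (m i 1)) *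
    (\<Prod>i = l..r. real (nn i) powi (int (c i) - 1))"
  have \<kappa>: "real (card {x \<in> parent_data S m n. out_type_function n x = \<tau>}) = \<kappa>"
    if \<tau>: "\<tau> \<in> type_functions S m n" for \<tau>
  proof -
    have pos: "(\<Prod>i = l..r. real (nn i)) > 0" using no_gap by (intro prod_pos) auto
    have count: "(\<Prod>i = l..r. real (nn i)) * real (card {x \<in> parent_data S m n. out_type_function n x = \<tau>}) =
      (\<Prod>i = l..-1. real (m i (-1))) * (\<Prod>i = 1..r. real (m i 1)) * (\<Prod>i = l..r. real (nn i) ^ c i)"
      using arg_cong[OF fibre[OF \<tau>], of real] by simp
    \<comment> \<open>The exponent is \<open>-1\<close> when \<open>c i = 0\<close>, hence the
      integer power; as \<open>nn i > 0\<close> on \<open>{l..r}\<close>, one more factor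
      \<open>nn i\<close> restores the natural power.\<close>
    have powi: "(\<Prod>i = l..r. real (nn i) powi (int (c i) - 1)) * (\<Prod>i = l..r. real (nn i)) =
      (\<Prod>i = l..r. real (nn i) ^ c i)"
      unfolding prod.distrib[symmetric]
    proof (rule prod.cong[OF refl])
      fix i assume "i \<in> {l..r}"
      then have "real (nn i) \<noteq> 0" using no_gap by auto
      then show "real (nn i) powi (int (c i) - 1) * real (nn i) = real (nn i) ^ c i"
        by (simp add: power_int_diff)
    qed
    have "(\<Prod>i = l..r. real (nn i)) *
      real (card {x \<in> parent_data S m n. out_type_function n x = \<tau>}) = (\<Prod>i = l..r. real (nn i)) * \<kappa>"
      unfolding count \<kappa>_def powi[symmetric] by (simp only: ac_simps)
    then show ?thesis unfolding mult_cancel_left using pos by (metis less_irrefl)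
  qed
  \<comment> \<open>An infinite set would have cardinality 0, whereas this cardinality divides
    \<open>fact n\<close>.\<close>
  have "finite (type_functions S m n)"
    using card_type_functions[OF finite_support n] by (intro card_ge_0_finite) (auto intro: ccontr)
  then have "card (\<Union>\<tau>\<in>type_functions S m n. {x \<in> parent_data S m n. out_type_function n x = \<tau>}) =
    (\<Sum>\<tau>\<in>type_functions S m n. card {x \<in> parent_data S m n. out_type_function n x = \<tau>})"
  proof (rule card_UN_disjoint)
    show "\<forall>\<tau>\<in>type_functions S m n. finite {x \<in> parent_data S m n. out_type_function n x = \<tau>}"
    proof
      fix \<tau> assume \<tau>: "\<tau> \<in> type_functions S m n"
      obtain \<rho> where "\<rho> \<in> ?V" "\<And>v. v \<in> ?V \<Longrightarrow> \<tau> v = None \<longleftrightarrow> v = \<rho>"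
        using type_functions_root[OF \<tau>] by blast
      then show "finite {x \<in> parent_data S m n. out_type_function n x = \<tau>}"
        by (rule parent_data_fibre(2)[OF \<tau>])
    qed
  qed auto
  moreover have "(\<Union>\<tau>\<in>type_functions S m n. {x \<in> parent_data S m n. out_type_function n x = \<tau>}) =
    parent_data S m n" using out_type_function_in by blast
  ultimately have "real (card (parent_data S m n)) = real (card (type_functions S m n)) * \<kappa>"
    using \<kappa> by simp
  moreover have fact: "real (card (type_functions S m n)) * (\<Prod>(i, s)\<in>?T. fact (m i s)) = fact n"
    using arg_cong[OF card_type_functions[OF finite_support n], of real]
    by (simp add: case_prod_beta)
  moreover have "(\<Prod>(i, s)\<in>?T. fact (m i s)) \<noteq> (0::real)"
    using finite_support by (auto simp: prod_zero_iff)
  ultimately have "real (card (parent_data S m n)) = fact n / (\<Prod>(i, s)\<in>?T. fact (m i s)) * \<kappa>"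
    by (simp add: field_simps)
  then show ?thesis
    unfolding card_embedded_trees_eq_parent_data[OF finite_support n] \<kappa>_def
    by (simp add: mult_ac)
qed

end
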